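(* Let $0<a,b,c\leq 1$ be real numbers. For a positive integer $N$, let $\mathcal{N}(a,b,c,N)$ denote the number of triples $(A,B,C)$ of relatively prime integers with $A+B+C=0$, $|A|,|B|,|C|\leq N$, and $r(A)\leq |A|^a$, $r(B)\leq |B|^b$, $r(C)\leq |C|^c$. Then for every $\epsilon>0$, $$\mathcal{N}(a,b,c,N)=O\left(N^{a+b+c-1+\epsilon}+N^{1+\epsilon}\right),$$ where the implied constant may depend on $\epsilon$ (and $a,b,c$) but not on $N$.
   Context: For a nonzero integer $n$, $r(n)=\prod_{p\mid n}p$ denotes the product of the distinct primes dividing $n$ (the radical of $n$). Triples are counted as ordered triples. *)

theory Defs
  imports Complex_Main "HOL-Computational_Algebra.Primes"
begin

(* On int, prime factors are positive, so the sign of n plays no role. The value at 0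
   is the junk value 1 (the empty product). *)
definition int_radical :: "int \<Rightarrow> int" where
  "int_radical n = (\<Prod>p\<in>prime_factors n. p)"

(* The radical is meaningful only for nonzero integers, so zero entries are excluded.
   As A + B + C = 0, a common divisor of two entries divides the third, so coprimality
   of the triple and pairwise coprimality agree. *)
definition restricted_triples :: "real \<Rightarrow> real \<Rightarrow> real \<Rightarrow> nat \<Rightarrow> (int \<times> int \<times> int) set" where
  "restricted_triples a b c N =
    {(A, B, C). A \<noteq> 0 \<and> B \<noteq> 0 \<and> C \<noteq> 0 \<and>
       Gcd {A, B, C} = 1 \<and> A + B + C = 0 \<and>
       \<bar>A\<bar> \<le> int N \<and> \<bar>B\<bar> \<le> int N \<and> \<bar>C\<bar> \<le> int N \<and>
       real_of_int (int_radical A) \<le> \<bar>real_of_int A\<bar> powr a \<and>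
       real_of_int (int_radical B) \<le> \<bar>real_of_int B\<bar> powr b \<and>
       real_of_int (int_radical C) \<le> \<bar>real_of_int C\<bar> powr c}"

definition restricted_count :: "real \<Rightarrow> real \<Rightarrow> real \<Rightarrow> nat \<Rightarrow> nat" where
  "restricted_count a b c N = card (restricted_triples a b c N)"

lemma finite_restricted_triples: "finite (restricted_triples a b c N)"
proof (rule finite_subset)
  show "restricted_triples a b c N \<subseteq>
      {- int N..int N} \<times> {- int N..int N} \<times> {- int N..int N}"
    by (auto simp: restricted_triples_def)
qed auto

end

(* Write each entry of a triple as x * y^2 * t, where x and y collect the primes of exponent one
   and two and t is cube-full, so that its radical is x * y * r(t) and r(t)^3 <= t. Arrange the
   triple as A + B = C with 0 < A <= B and confine the nine quantities x, y, r(t) to dyadic boxes.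
   With everything but the three x fixed, the solutions are primitive points on a line; with
   everything but the three y fixed, they are primitive points on a diagonal conic. In both cases
   the slopes of distinct points (on the conic: distinct points satisfying the same congruences) are
   so well separated that there are, up to divisor functions, at most 1 + O(V / C) of them, V being
   the volume of the box of the three variables. The terms V / C add up to C^(a+b+c-1). If P and Q
   are the numbers of lines and of conics, the terms 1 add up to min(P, Q), and
   P^2 Q <= 64^3 A B C gives min(P, Q) = O(N). *)
theory Submission
  imports Defs "HOL-Library.Discrete_Functions"
begin

section \<open>Radicals and integers composed of given primes\<close>

text \<open>Every curve costs at least 1, however few points it carries. Lines are too many when the
  double parts are large, conics when the simple parts are large, so neither family suffices alone.
  In \<open>P * P * Q\<close> the simple parts occur once, the double parts twice and the radicals
  of the cube-full parts three times, at most the weight that each has in the entry itself; this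
  balance is why exponents are split at three. A box confines r(t) and not t because the hypotheses
  bound radicals, and only N^\<delta> integers up to N share one. The obstacle on a conic is that
  primitive points may lie close together. Only points of one class modulo all three coefficients
  are forced apart, since their polar form is then divisible by almost the whole product
  \<open>u * v * w\<close>; the number of classes has to be controlled by divisor functions. Three
  losses make up the N^\<epsilon>: the dyadic boxes, the integers with a given radical, and the
  divisors. The last two come from one estimate for integers composed of given primes.\<close>

definition rad :: "nat \<Rightarrow> nat" where
  "rad n = (\<Prod>p\<in>prime_factors n. p)"

lemma rad_pos: "0 < rad n"
  unfolding rad_def by (intro prod_pos) (simp add: prime_factors_gt_0_nat)

lemma prime_factors_prod_primes:
  assumes "finite S" "\<And>p. p \<in> S \<Longrightarrow> prime (p::nat)" "\<And>p. p \<in> S \<Longrightarrow> 0 < e p"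
  shows "prime_factors (\<Prod>p\<in>S. p ^ e p) = S"
proof -
  have "0 \<notin> (\<lambda>p. p ^ e p) ` S"
    using assms(2)[of 0] by auto
  then have "prime_factors (\<Prod>p\<in>S. p ^ e p) = (\<Union>p\<in>S. prime_factors (p ^ e p))"
    using assms(1) by (simp add: prime_factors_prod)
  also have "\<dots> = (\<Union>p\<in>S. {p})"
    using assms by (intro SUP_cong) (auto simp: prime_factorization_prime_power)
  finally show ?thesis by simp
qed

lemma prime_factors_rad: "prime_factors (rad n) = prime_factors n"
  using prime_factors_prod_primes[of "prime_factors n" "\<lambda>_. 1"]
  by (simp add: rad_def in_prime_factors_iff)

lemma rad_le: "0 < n \<Longrightarrow> rad n \<le> n"
proof -
  assume "0 < n"
  then have "n = (\<Prod>p\<in>prime_factors n. p ^ multiplicity p n)"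
    using prime_factorization_nat by blast
  also have "\<dots> \<ge> (\<Prod>p\<in>prime_factors n. p)"
  proof (intro prod_mono conjI)
    fix p assume p: "p \<in> prime_factors n"
    then have "0 < multiplicity p n" "0 < p"
      by (auto simp: prime_factors_multiplicity prime_gt_0_nat)
    then show "p \<le> p ^ multiplicity p n"
      by (intro self_le_power) auto
  qed simp
  finally show ?thesis by (simp add: rad_def)
qed

lemma int_radical_eq: "int_radical n = int (rad (nat \<bar>n\<bar>))"
proof -
  have "prime_factors n = int ` prime_factors (nat \<bar>n\<bar>)"
  proof (intro equalityI subsetI)
    fix p assume p: "p \<in> prime_factors n"
    then obtain q where q: "p = int q"
      using prime_factors_gt_0_int[of p n] zero_le_imp_eq_int[of p] by auto
    with p have "q \<in> prime_factors (nat \<bar>n\<bar>)"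
      by (simp add: in_prime_factors_iff)
    with q show "p \<in> int ` prime_factors (nat \<bar>n\<bar>)" by blast
  next
    fix p assume "p \<in> int ` prime_factors (nat \<bar>n\<bar>)"
    then show "p \<in> prime_factors n"
      by (auto simp: in_prime_factors_iff)
  qed
  then show ?thesis
    by (simp add: int_radical_def rad_def prod.reindex)
qed

section \<open>Splitting an integer by the exponents of its primes: one, two, at least three\<close>

definition simple_part :: "nat \<Rightarrow> nat" where
  "simple_part n = (\<Prod>p\<in>{p \<in> prime_factors n. multiplicity p n = 1}. p)"

definition double_part :: "nat \<Rightarrow> nat" where
  "double_part n = (\<Prod>p\<in>{p \<in> prime_factors n. multiplicity p n = 2}. p)"

definition cubefull_part :: "nat \<Rightarrow> nat" where
  "cubefull_part n = (\<Prod>p\<in>{p \<in> prime_factors n. 3 \<le> multiplicity p n}. p ^ multiplicity p n)"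

lemma rad_cubefull_part:
  "rad (cubefull_part n) = (\<Prod>p\<in>{p \<in> prime_factors n. 3 \<le> multiplicity p n}. p)"
proof -
  have "prime_factors (cubefull_part n) = {p \<in> prime_factors n. 3 \<le> multiplicity p n}"
    unfolding cubefull_part_def
  proof (rule prime_factors_prod_primes)
    fix p assume "p \<in> {p \<in> prime_factors n. 3 \<le> multiplicity p n}"
    then show "prime p" "0 < multiplicity p n"
      using in_prime_factors_imp_prime[of p n] by auto
  qed simp
  then show ?thesis by (simp add: rad_def)
qed

lemma parts_mult:
  assumes "0 < n"
  shows "simple_part n * (double_part n)\<^sup>2 * cubefull_part n = n"
proof -
  let ?m = "\<lambda>p. multiplicity p n"
  have "n = (\<Prod>p\<in>prime_factors n. p ^ ?m p)"
    using assms prime_factorization_nat by blast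
  also have "\<dots> = (\<Prod>p\<in>prime_factors n. (if ?m p = 1 then p else 1) *
      (if ?m p = 2 then p\<^sup>2 else 1) * (if 3 \<le> ?m p then p ^ ?m p else 1))"
  proof (intro prod.cong refl)
    fix p assume "p \<in> prime_factors n"
    then have "0 < ?m p" by (simp add: prime_factors_multiplicity)
    then consider "?m p = 1" | "?m p = 2" | "3 \<le> ?m p" by linarith
    then show "p ^ ?m p = (if ?m p = 1 then p else 1) *
      (if ?m p = 2 then p\<^sup>2 else 1) * (if 3 \<le> ?m p then p ^ ?m p else 1)"
      by cases auto
  qed
  also have "\<dots> = simple_part n * (double_part n)\<^sup>2 * cubefull_part n"
    unfolding simple_part_def double_part_def cubefull_part_def prod_power_distrib
    by (simp only: prod.distrib prod.inter_filter finite_set_mset)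
  finally show ?thesis by simp
qed

lemma parts_rad:
  "simple_part n * double_part n * rad (cubefull_part n) = rad n"
proof -
  let ?m = "\<lambda>p. multiplicity p n"
  have "rad n = (\<Prod>p\<in>prime_factors n. (if ?m p = 1 then p else 1) *
      (if ?m p = 2 then p else 1) * (if 3 \<le> ?m p then p else 1))"
    unfolding rad_def
  proof (intro prod.cong refl)
    fix p assume "p \<in> prime_factors n"
    then have "0 < ?m p" by (simp add: prime_factors_multiplicity)
    then consider "?m p = 1" | "?m p = 2" | "3 \<le> ?m p" by linarith
    then show "p = (if ?m p = 1 then p else 1) *
      (if ?m p = 2 then p else 1) * (if 3 \<le> ?m p then p else 1)"
      by cases auto
  qed
  also have "\<dots> = simple_part n * double_part n * rad (cubefull_part n)"
    unfolding simple_part_def double_part_def rad_cubefull_part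
    by (simp only: prod.distrib prod.inter_filter finite_set_mset)
  finally show ?thesis by simp
qed

lemma rad_cubefull_part_cube_le: "rad (cubefull_part n) ^ 3 \<le> cubefull_part n"
  unfolding rad_cubefull_part unfolding cubefull_part_def prod_power_distrib
proof (intro prod_mono conjI)
  fix p assume p: "p \<in> {p \<in> prime_factors n. 3 \<le> multiplicity p n}"
  then have "0 < p" using prime_factors_gt_0_nat[of p n] by simp
  then show "p ^ 3 \<le> p ^ multiplicity p n"
    using p by (intro power_increasing) auto
qed simp

lemma parts_pos:
  assumes "0 < n"
  shows "0 < simple_part n" "0 < double_part n" "0 < cubefull_part n"
proof -
  have "simple_part n * (double_part n)\<^sup>2 * cubefull_part n \<noteq> 0"
    using parts_mult[OF assms] assms by linarith
  then show "0 < simple_part n" "0 < double_part n" "0 < cubefull_part n"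
    by auto
qed

section \<open>Rankin's method for integers supported on given primes\<close>

definition factored_count :: "nat set \<Rightarrow> nat \<Rightarrow> nat" where
  "factored_count S N = card {m. 0 < m \<and> m \<le> N \<and> prime_factors m \<subseteq> S}"

text \<open>The multiples of \<open>p\<close> are the \<open>p * k\<close> with \<open>k\<close> up
  to \<open>N div p\<close>. \<open>k\<close> may again contain \<open>p\<close>, so the recursion
  keeps \<open>insert p S\<close> and sums up to the geometric series of an Euler factor.\<close>

lemma factored_count_insert_le:
  assumes "prime p"
  shows "factored_count (insert p S) N \<le> factored_count S N + factored_count (insert p S) (N div p)"
proof -
  let ?A = "\<lambda>S (N::nat). {m. 0 < m \<and> m \<le> N \<and> prime_factors m \<subseteq> S}"
  have fin: "finite (?A S N)" for S N
    by (rule finite_subset[of _ "{..N}"]) auto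
  have "?A (insert p S) N \<subseteq> ?A S N \<union> (\<lambda>m. p * m) ` ?A (insert p S) (N div p)"
  proof
    fix m assume m: "m \<in> ?A (insert p S) N"
    show "m \<in> ?A S N \<union> (\<lambda>m. p * m) ` ?A (insert p S) (N div p)"
    proof (cases "p dvd m")
      case True
      then obtain k where k: "m = p * k" by blast
      then have "k \<in> ?A (insert p S) (N div p)"
        using m assms prime_gt_0_nat[OF assms]
        by (auto simp: less_eq_div_iff_mult_less_eq mult.commute prime_factors_product)
      then show ?thesis using k by blast
    next
      case False
      then show ?thesis using m by (auto simp: in_prime_factors_iff)
    qed
  qed
  then have "card (?A (insert p S) N) \<le> card (?A S N \<union> (\<lambda>m. p * m) ` ?A (insert p S) (N div p))"
    using fin by (intro card_mono) auto
  also have "\<dots> \<le> card (?A S N) + card ((\<lambda>m. p * m) ` ?A (insert p S) (N div p))"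
    by (rule card_Un_le)
  also have "\<dots> \<le> card (?A S N) + card (?A (insert p S) (N div p))"
    using card_image_le[OF fin] by simp
  finally show ?thesis by (simp add: factored_count_def)
qed

text \<open>Rankin's bound: each \<open>m\<close> counted contributes at most (N/m)^\<delta>, and
  the sum of m^(-\<delta>) over all integers supported on \<open>S\<close> is the Euler product. The
  induction replaces this infinite sum.\<close>

lemma factored_count_le_prod:
  assumes "0 < \<delta>" "finite S" "\<And>p. p \<in> S \<Longrightarrow> prime p"
  shows "real (factored_count S N) \<le> real N powr \<delta> * (\<Prod>p\<in>S. 1 / (1 - real p powr -\<delta>))"
  using assms(2,3)
proof (induction S arbitrary: N)
  case empty
  have "{m. 0 < m \<and> m \<le> N \<and> prime_factors m \<subseteq> {}} \<subseteq> (if N = 0 then {} else {1})"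
    by (auto simp: prime_factorization_empty_iff)
  then have "factored_count {} N \<le> card (if N = 0 then {} else {1::nat})"
    unfolding factored_count_def by (intro card_mono) auto
  then show ?case
    using ge_one_powr_ge_zero[of "real N" \<delta>] assms(1) by (auto split: if_splits)
next
  case (insert p S)
  have p: "prime p" using insert by auto
  define t where "t = real p powr -\<delta>"
  define P where "P = (\<Prod>p\<in>S. 1 / (1 - real p powr -\<delta>))"
  have t_lt: "real q powr -\<delta> < 1" if "prime q" for q
    using that assms(1) prime_gt_1_nat[OF that] by (simp add: powr_minus powr_less_one inverse_less_1_iff)
  have t: "0 < t" "t < 1"
    using t_lt[OF p] prime_gt_0_nat[OF p] by (auto simp: t_def)
  have P: "0 \<le> P"
    unfolding P_def using insert.prems t_lt by (intro prod_nonneg) (auto simp: less_imp_le)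
  \<comment> \<open>\<open>P / (1 - t)\<close> is the fixed point of x = P + t * x, which is the
    recursion of \<open>factored_count_insert_le\<close> after scaling by
    \<open>N powr \<delta>\<close>.\<close>
  have "real (factored_count (insert p S) N) \<le> real N powr \<delta> * (P / (1 - t))"
  proof (induction N rule: less_induct)
    case (less N)
    show ?case
    proof (cases "N = 0")
      case True
      then have e: "{m. 0 < m \<and> m \<le> N \<and> prime_factors m \<subseteq> insert p S} = {}" by auto
      show ?thesis unfolding factored_count_def e using True by simp
    next
      case False
      then have N: "N div p < N" using prime_gt_1_nat[OF p] by simp
      have dv: "real (N div p) powr \<delta> \<le> real N powr \<delta> * t"
      proof -
        have "real (N div p) powr \<delta> \<le> (real N / real p) powr \<delta>"
          using assms(1) of_nat_div_le_of_nat[of N p, where 'a=real] by (intro powr_mono2) auto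
        also have "\<dots> = real N powr \<delta> * t"
          by (simp add: t_def powr_divide powr_minus field_simps)
        finally show ?thesis .
      qed
      have "real (factored_count (insert p S) N)
          \<le> real (factored_count S N) + real (factored_count (insert p S) (N div p))"
        using factored_count_insert_le[OF p, of S N] by linarith
      also have "\<dots> \<le> real N powr \<delta> * P + real (N div p) powr \<delta> * (P / (1 - t))"
        using insert.IH insert.prems less.IH[OF N] by (intro add_mono) (auto simp: P_def)
      also have "\<dots> \<le> real N powr \<delta> * P + real N powr \<delta> * t * (P / (1 - t))"
        using dv P t by (intro add_left_mono mult_right_mono) auto
      also have "\<dots> = real N powr \<delta> * (P / (1 - t))"
        using t by (simp add: field_simps)
      finally show ?thesis .
    qed
  qed
  then show ?case
    using insert by (simp add: P_def t_def)
qed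

text \<open>With q = p^\<delta>, the factor 1/(1 - 1/q) is at most q as soon as q is at least 2.
  Only primes below 2^(1/\<delta>) violate this; there are at most \<open>L\<close> of them for any
  \<open>S\<close>, and each costs a factor at most \<open>K\<close>, the Euler factor at 2.\<close>

lemma prod_euler_factor_le:
  assumes "0 < \<delta>"
  obtains C where "1 \<le> C"
    "\<And>S. finite S \<Longrightarrow> (\<And>p. p \<in> S \<Longrightarrow> prime p) \<Longrightarrow>
       (\<Prod>p\<in>S. 1 / (1 - real p powr -\<delta>)) \<le> C * real (\<Prod>S) powr \<delta>"
proof
  define L where "L = nat \<lceil>2 powr (1 / \<delta>)\<rceil>"
  define K where "K = 1 / (1 - 2 powr -\<delta>)"
  have K: "1 \<le> K"
    using assms by (simp add: K_def powr_minus powr_less_one inverse_less_1_iff field_simps)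
  show "1 \<le> K ^ L" using K by simp
  fix S :: "nat set" assume S: "finite S" "\<And>p. p \<in> S \<Longrightarrow> prime p"
  have pos: "real p powr -\<delta> < 1" if "p \<in> S" for p
    using assms prime_gt_1_nat[OF S(2)[OF that]] by (simp add: powr_minus inverse_less_1_iff)
  have "(\<Prod>p\<in>S. 1 / (1 - real p powr -\<delta>))
      \<le> (\<Prod>p\<in>S. (if p < L then K else 1) * real p powr \<delta>)"
  proof (intro prod_mono conjI)
    fix p assume p: "p \<in> S"
    show "0 \<le> 1 / (1 - real p powr -\<delta>)" using pos[OF p] by simp
    have p2: "2 \<le> p" using S(2)[OF p] prime_ge_2_nat by blast
    have p1: "1 \<le> real p powr \<delta>"
      using p2 assms by (intro ge_one_powr_ge_zero) auto
    show "1 / (1 - real p powr -\<delta>) \<le> (if p < L then K else 1) * real p powr \<delta>"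
    proof (cases "p < L")
      case True
      have "real p powr -\<delta> \<le> 2 powr -\<delta>"
        using p2 assms by (intro powr_mono2') auto
      then have "1 / (1 - real p powr -\<delta>) \<le> K"
        unfolding K_def using assms by (intro frac_le) (auto intro: pos[OF p] simp: powr_less_one)
      also have "\<dots> \<le> K * real p powr \<delta>"
        using K p1 by simp
      finally show ?thesis using True by simp
    next
      case False
      then have "2 powr (1 / \<delta>) \<le> real p" unfolding L_def by linarith
      then have "(2 powr (1 / \<delta>)) powr \<delta> \<le> real p powr \<delta>"
        using assms by (intro powr_mono2) auto
      then have "2 \<le> real p powr \<delta>" using assms by (simp add: powr_powr)
      then have "1 / (1 - real p powr -\<delta>) \<le> real p powr \<delta>"
        by (simp add: powr_minus divide_simps prime_gt_0_nat S(2)[OF p])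
      then show ?thesis using False by simp
    qed
  qed
  also have "\<dots> = (\<Prod>p\<in>S. if p < L then K else 1) * (\<Prod>p\<in>S. real p powr \<delta>)"
    by (simp add: prod.distrib)
  also have "(\<Prod>p\<in>S. real p powr \<delta>) = real (\<Prod>S) powr \<delta>"
    by (simp add: prod_powr_distrib)
  also have "(\<Prod>p\<in>S. if p < L then K else 1) = K ^ card {p \<in> S. p < L}"
    using S(1) by (simp flip: prod.inter_filter)
  also have "\<dots> \<le> K ^ L"
  proof (intro power_increasing K)
    have "card {p \<in> S. p < L} \<le> card {..<L}" by (intro card_mono) auto
    then show "card {p \<in> S. p < L} \<le> L" by simp
  qed
  finally show "(\<Prod>p\<in>S. 1 / (1 - real p powr -\<delta>)) \<le> K ^ L * real (\<Prod>S) powr \<delta>"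
    by (simp add: mult_right_mono)
qed

text \<open>Half of the exponent pays for Rankin's bound. The other half absorbs the Euler product,
  which is at most a power of \<Prod>S and hence of \<open>N\<close>.\<close>

lemma factored_count_bound:
  assumes "0 < \<delta>"
  obtains C where "1 \<le> C"
    "\<And>S N. finite S \<Longrightarrow> (\<And>p. p \<in> S \<Longrightarrow> prime p) \<Longrightarrow> \<Prod>S \<le> N \<Longrightarrow>
       real (factored_count S N) \<le> C * real N powr \<delta>"
proof -
  have d: "0 < \<delta> / 2" using assms by simp
  obtain C where C: "1 \<le> C" "\<And>S. finite S \<Longrightarrow> (\<And>p. p \<in> S \<Longrightarrow> prime p) \<Longrightarrow>
       (\<Prod>p\<in>S. 1 / (1 - real p powr -(\<delta>/2))) \<le> C * real (\<Prod>S) powr (\<delta>/2)"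
    using prod_euler_factor_le[OF d] by metis
  show thesis
  proof (rule that[OF C(1)])
    fix S :: "nat set" and N :: nat
    assume S: "finite S" "\<And>p. p \<in> S \<Longrightarrow> prime p" "\<Prod>S \<le> N"
    have "real (factored_count S N) \<le> real N powr (\<delta>/2) * (\<Prod>p\<in>S. 1 / (1 - real p powr -(\<delta>/2)))"
      using factored_count_le_prod[OF d] S by blast
    also have "\<dots> \<le> real N powr (\<delta>/2) * (C * real (\<Prod>S) powr (\<delta>/2))"
      using C(2)[of S] S by (intro mult_left_mono) auto
    also have "\<dots> \<le> real N powr (\<delta>/2) * (C * real N powr (\<delta>/2))"
      using S(3) d C(1) by (intro mult_left_mono powr_mono2) (auto simp flip: of_nat_prod)
    also have "\<dots> = C * real N powr \<delta>"
      by (simp add: mult.left_commute flip: powr_add)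
    finally show "real (factored_count S N) \<le> C * real N powr \<delta>" .
  qed
qed

lemma divisor_count_le:
  assumes "0 < n"
  shows "card {d. d dvd n} \<le> factored_count (prime_factors n) n"
proof -
  have "{d. d dvd n} \<subseteq> {m. 0 < m \<and> m \<le> n \<and> prime_factors m \<subseteq> prime_factors n}"
    using assms dvd_prime_factors[of n] by (auto intro: dvd_imp_le Nat.gr0I)
  moreover have "finite {m. 0 < m \<and> m \<le> n \<and> prime_factors m \<subseteq> prime_factors n}"
    by (rule finite_subset[of _ "{..n}"]) auto
  ultimately show ?thesis
    unfolding factored_count_def by (rule card_mono[rotated])
qed

text \<open>There are at most \<open>R\<close> values of the radical, and the integers sharing the
  radical \<open>r\<close> are supported on the primes of \<open>r\<close>.\<close>

lemma rad_count_le: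
  assumes C: "\<And>S N. finite S \<Longrightarrow> (\<And>p. p \<in> S \<Longrightarrow> prime p) \<Longrightarrow> \<Prod>S \<le> N \<Longrightarrow>
       real (factored_count S N) \<le> C * real N powr \<delta>" and C0: "0 \<le> C"
  shows "real (card {m. 0 < m \<and> m \<le> N \<and> rad m \<le> R}) \<le> real R * (C * real N powr \<delta>)"
proof -
  let ?M = "\<lambda>r. {m. 0 < m \<and> m \<le> N \<and> rad m = r}"
  have one: "real (card (?M r)) \<le> C * real N powr \<delta>" for r
  proof (cases "?M r = {}")
    case True
    then show ?thesis using C0 by (simp only: card.empty) simp
  next
    case False
    \<comment> \<open>A witness shows that \<open>r\<close> is a radical, so the product of its
      primes is \<open>r\<close> itself and at most \<open>N\<close>, as the hypothesis
      \<open>C\<close> demands.\<close>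
    then obtain m0 where m0: "0 < m0" "m0 \<le> N" "rad m0 = r" by blast
    then have r: "prime_factors r = prime_factors m0" "\<Prod>(prime_factors r) = r"
      using prime_factors_rad rad_def by auto
    have "r \<le> N" using rad_le[OF m0(1)] m0(2,3) by simp
    have "card (?M r) \<le> factored_count (prime_factors r) N"
      unfolding factored_count_def
      by (rule card_mono, rule finite_subset[of _ "{..N}"]) (auto simp: prime_factors_rad)
    moreover have "real (factored_count (prime_factors r) N) \<le> C * real N powr \<delta>"
      using r \<open>r \<le> N\<close> by (intro C) (auto simp: in_prime_factors_iff)
    ultimately show ?thesis by linarith
  qed
  have "{m. 0 < m \<and> m \<le> N \<and> rad m \<le> R} \<subseteq> (\<Union>r\<in>{1..R}. ?M r)"
    using rad_pos by (auto simp: Suc_le_eq)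
  then have "card {m. 0 < m \<and> m \<le> N \<and> rad m \<le> R} \<le> card (\<Union>r\<in>{1..R}. ?M r)"
    by (intro card_mono finite_UN_I) auto
  also have "\<dots> \<le> (\<Sum>r\<in>{1..R}. card (?M r))"
    by (intro card_UN_le) simp
  finally have "real (card {m. 0 < m \<and> m \<le> N \<and> rad m \<le> R}) \<le> (\<Sum>r\<in>{1..R}. real (card (?M r)))"
    by (simp only: of_nat_le_iff flip: of_nat_sum)
  also have "\<dots> \<le> (\<Sum>r\<in>{1..R}. C * real N powr \<delta>)"
    by (intro sum_mono one)
  finally show ?thesis by simp
qed

section \<open>Primitive points on lines and conics\<close>

lemma card_separated_le:
  fixes f :: "'a \<Rightarrow> real"
  assumes "finite S" "0 < h" "0 \<le> W"
    and range: "\<And>s. s \<in> S \<Longrightarrow> 0 \<le> f s \<and> f s \<le> W"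
    and sep: "\<And>s t. s \<in> S \<Longrightarrow> t \<in> S \<Longrightarrow> s \<noteq> t \<Longrightarrow> h \<le> \<bar>f s - f t\<bar>"
  shows "real (card S) \<le> 1 + W / h"
proof -
  define g where "g s = nat \<lfloor>f s / h\<rfloor>" for s
  have g: "real (g s) \<le> f s / h" "f s / h < real (g s) + 1" if "s \<in> S" for s
    using range[OF that] assms(2) unfolding g_def by (auto simp: of_nat_nat)
  have "inj_on g S"
  proof (rule inj_onI, rule ccontr)
    fix s t assume st: "s \<in> S" "t \<in> S" "g s = g t" "s \<noteq> t"
    have "\<bar>f s / h - f t / h\<bar> < 1"
      using g[OF st(1)] g[OF st(2)] st(3) by linarith
    then have "\<bar>f s - f t\<bar> < h"
      using assms(2) by (simp add: abs_if field_simps split: if_splits)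
    then show False using sep[OF st(1,2,4)] by linarith
  qed
  moreover have "g ` S \<subseteq> {..nat \<lfloor>W / h\<rfloor>}"
    using range assms(2) unfolding g_def
    by (auto intro!: nat_mono floor_mono divide_right_mono)
  ultimately have "card S \<le> card {..nat \<lfloor>W / h\<rfloor>}"
    by (intro card_inj_on_le) auto
  also have "real (card {..nat \<lfloor>W / h\<rfloor>}) \<le> 1 + W / h"
    using assms(2,3) by (simp add: of_nat_nat)
  finally show ?thesis by simp
qed

text \<open>Separation is asked of the numerator \<open>x * z' - x' * z\<close> of a difference of
  slopes, because this is the integer that the arithmetic of the line or conic bounds from below.
  The condition \<open>Z \<le> 2 * z\<close> keeps all slopes in an interval of length
  \<open>2 * X / Z\<close>.\<close>

lemma card_separated_fractions_le:
  fixes S :: "(nat \<times> nat \<times> nat) set" and X Z :: nat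
  assumes "finite S" "0 < Z" "0 < h"
    and box: "\<And>x y z. (x, y, z) \<in> S \<Longrightarrow> x \<le> X \<and> 0 < z \<and> Z \<le> 2 * z"
    and sep: "\<And>x y z x' y' z'. (x, y, z) \<in> S \<Longrightarrow> (x', y', z') \<in> S \<Longrightarrow> (x, y, z) \<noteq> (x', y', z')
      \<Longrightarrow> h * (real z * real z') \<le> \<bar>real x * real z' - real x' * real z\<bar>"
  shows "real (card S) \<le> 1 + 2 * real X / (real Z * h)"
proof -
  have "real (card S) \<le> 1 + (2 * real X / real Z) / h"
  proof (rule card_separated_le[where f = "\<lambda>(x, y, z). real x / real z"])
    fix s assume s: "s \<in> S"
    obtain x y z where xyz: "s = (x, y, z)" by (cases s)
    have b: "x \<le> X" "0 < z" "Z \<le> 2 * z" using box s xyz by auto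
    have "real x * real Z \<le> real X * (2 * real z)"
      using b by (intro mult_mono) auto
    then show "0 \<le> (case s of (x, y, z) \<Rightarrow> real x / real z) \<and>
        (case s of (x, y, z) \<Rightarrow> real x / real z) \<le> 2 * real X / real Z"
      using b assms(2) by (simp add: xyz field_simps)
    fix t assume t: "t \<in> S" "s \<noteq> t"
    obtain x' y' z' where xyz': "t = (x', y', z')" by (cases t)
    have b': "0 < z'" using box t xyz' by auto
    have "h * (real z * real z') \<le> \<bar>real x * real z' - real x' * real z\<bar>"
      using sep s t xyz xyz' by metis
    moreover have "\<bar>real x / real z - real x' / real z'\<bar>
        = \<bar>real x * real z' - real x' * real z\<bar> / (real z * real z')"
      using b b' by (simp add: diff_frac_eq abs_mult)
    ultimately show "h \<le> \<bar>(case s of (x, y, z) \<Rightarrow> real x / real z) - (case t of (x, y, z) \<Rightarrow> real x / real z)\<bar>"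
      using b b' by (simp add: xyz xyz' pos_le_divide_eq)
  qed (use assms in auto)
  then show ?thesis by simp
qed

lemma coprime_summands:
  fixes p q r :: nat
  assumes "p + q = r" "coprime p q"
  shows "coprime p r" "coprime q r"
proof -
  have "gcd p r = gcd p q" "gcd q r = gcd q p"
    unfolding assms(1)[symmetric] by simp (metis add.commute gcd_add2)
  then show "coprime p r" "coprime q r"
    using assms(2) by (simp_all add: coprime_iff_gcd_eq_1 gcd.commute)
qed

text \<open>Eliminating \<open>w\<close> from two solutions gives u * (x z' - x' z) = v * (z y' - z'
  y). As \<open>u\<close> and \<open>v\<close> are coprime, \<open>v\<close> divides the determinant
  of two points, so slopes differ by at least v / Z^2. The base point serves to express the result
  by the common size \<open>w * z0\<close> of the sum.\<close>

lemma linear_points_count: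
  fixes S :: "(nat \<times> nat \<times> nat) set" and u v w X Y Z :: nat
  assumes "finite S"
    and box: "\<And>x y z. (x, y, z) \<in> S \<Longrightarrow>
      0 < x \<and> x \<le> X \<and> 0 < y \<and> y \<le> Y \<and> 0 < z \<and> z \<le> Z \<and> Z \<le> 2 * z"
    and pos: "0 < u" "0 < v" "0 < w"
    and sol: "\<And>x y z. (x, y, z) \<in> S \<Longrightarrow>
      u * x + v * y = w * z \<and> u * x \<le> v * y \<and> coprime (u * x) (v * y)"
    and mem: "(x0, y0, z0) \<in> S"
  shows "real (card S) \<le> 1 + 4 * (real X * real Y * real Z) / real (w * z0)"
proof -
  note b0 = box[OF mem]
  have Z: "0 < Z" and Y: "0 < Y" using b0 by auto
  have "real (card S) \<le> 1 + 2 * real X / (real Z * (real v / (real Z * real Z)))"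
  proof (rule card_separated_fractions_le[OF assms(1) Z])
    fix x y z x' y' z'
    assume p: "(x, y, z) \<in> S" "(x', y', z') \<in> S" "(x, y, z) \<noteq> (x', y', z')"
    note s = sol[OF p(1)] and s' = sol[OF p(2)] and b = box[OF p(1)] and b' = box[OF p(2)]
    let ?d = "int x * int z' - int x' * int z"
    have eq: "int u * int x + int v * int y = int w * int z"
      "int u * int x' + int v * int y' = int w * int z'"
      using s s' by (simp_all flip: of_nat_add of_nat_mult)
    have cop: "coprime x z" if "u * x + v * y = w * z" "coprime (u * x) (v * y)" for x y z
      using coprime_summands(1)[OF that] by simp
    have "int v dvd int u * ?d"
    proof
      have "int u * ?d = int z' * (int w * int z - int v * int y) - int z * (int w * int z' - int v * int y')"
        unfolding eq[symmetric] by (simp add: algebra_simps)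
      then show "int u * ?d = int v * (int z * int y' - int z' * int y)"
        by (simp add: algebra_simps)
    qed
    moreover have "coprime (int v) (int u)" using s by (simp add: coprime_commute)
    ultimately have dvd: "int v dvd ?d"
      by (simp add: coprime_dvd_mult_right_iff)
    \<comment> \<open>\<open>x\<close> is coprime to \<open>z\<close>, so equal slopes mean equal
      reduced fractions, and the equation then determines \<open>y\<close>.\<close>
    have ne: "?d \<noteq> 0"
    proof
      assume "?d = 0"
      then have "int (x * z') = int (x' * z)" by simp
      then have e: "x * z' = x' * z" by (simp only: of_nat_eq_iff)
      have "x dvd x' * z" "x' dvd x * z'" unfolding e[symmetric] by simp (simp add: e)
      then have "x dvd x'" "x' dvd x"
        using cop[of x y z] cop[of x' y' z'] s s' by (simp_all add: coprime_dvd_mult_left_iff)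
      then have "x = x'" by (rule dvd_antisym)
      then have "z = z'" using e b by auto
      moreover have "u * x' + v * y = u * x' + v * y'"
        using s s' \<open>x = x'\<close> \<open>z = z'\<close> by simp
      ultimately show False using \<open>x = x'\<close> p(3) pos by simp
    qed
    have "int v \<le> \<bar>?d\<bar>" using dvd_imp_le_int[OF ne dvd] by simp
    then have "real_of_int (int v) \<le> real_of_int \<bar>?d\<bar>" by (simp only: of_int_le_iff)
    then have v: "real v \<le> \<bar>real x * real z' - real x' * real z\<bar>" by simp
    have "real v / (real Z * real Z) * (real z * real z') \<le> real v / (real Z * real Z) * (real Z * real Z)"
      using b b' by (intro mult_left_mono mult_mono) auto
    also have "\<dots> = real v" using Z by simp
    finally show "real v / (real Z * real Z) * (real z * real z') \<le> \<bar>real x * real z' - real x' * real z\<bar>"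
      using v by linarith
  qed (use box Z pos in auto)
  also have "2 * real X / (real Z * (real v / (real Z * real Z))) = 2 * (real X * real Z) / real v"
    using Z pos by simp
  also have "\<dots> \<le> 4 * (real X * real Y * real Z) / real (w * z0)"
  proof -
    \<comment> \<open>The larger summand is at least half of the sum. Together with the 2 in the
      range of the slopes this makes the constant 4.\<close>
    have "w * z0 \<le> 2 * (v * y0)" using sol[OF mem] by linarith
    also have "\<dots> \<le> 2 * (v * Y)" using b0 by simp
    finally have "real (w * z0) \<le> real (2 * (v * Y))" by (rule of_nat_mono)
    then have "real (w * z0) \<le> 2 * real Y * real v" by (simp add: mult_ac)
    then have "2 * (real X * real Z) * real (w * z0) \<le> 2 * (real X * real Z) * (2 * real Y * real v)"
      by (intro mult_left_mono) auto
    moreover have v: "0 < real v" and c: "0 < real (w * z0)" using pos b0 by auto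
    ultimately show ?thesis
      unfolding pos_divide_le_eq[OF v] times_divide_eq_left pos_le_divide_eq[OF c]
      by (simp only: mult_ac)
  qed
  finally show ?thesis by simp
qed

text \<open>The class of a point relative to a base point, modulo \<open>n\<close>, is recorded by a gcd with \<open>n\<close>: modulo
  that divisor the ratio agrees with the one of the base point, modulo the complementary divisor it
  is its negative. This avoids counting square roots modulo \<open>n\<close>.\<close>

lemma conic_congruence:
  fixes n \<alpha> \<beta> a0 b0 a1 b1 a2 b2 :: int
  assumes n: "n dvd \<alpha> * a0\<^sup>2 + \<beta> * b0\<^sup>2" "n dvd \<alpha> * a1\<^sup>2 + \<beta> * b1\<^sup>2" "n dvd \<alpha> * a2\<^sup>2 + \<beta> * b2\<^sup>2"
    and cop: "coprime n \<alpha>" "coprime n b0" "coprime n a1"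
    and same: "gcd n (a1 * b0 - a0 * b1) = gcd n (a2 * b0 - a0 * b2)"
    and "n \<noteq> 0"
  shows "n dvd 2 * (\<alpha> * a1 * a2 + \<beta> * b1 * b2)"
proof -
  define g where "g = gcd n (a1 * b0 - a0 * b1)"
  have "g dvd n" by (simp add: g_def)
  then obtain h where h: "n = g * h" by blast
  have "g \<noteq> 0" using h \<open>n \<noteq> 0\<close> by auto
  let ?D = "a1 * b2 - a2 * b1"
  \<comment> \<open>Two zeros of the form modulo \<open>n\<close> make the product of difference and
    sum divisible by \<open>n\<close>. The gcd takes out the full share of the difference, so the
    cofactor \<open>h\<close> must divide the sum.\<close>
  have h_dvd: "h dvd a * b0 + a0 * b"
    if "n dvd \<alpha> * a\<^sup>2 + \<beta> * b\<^sup>2" "gcd n (a * b0 - a0 * b) = g" for a b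
  proof -
    have "n dvd (\<alpha> * a\<^sup>2 + \<beta> * b\<^sup>2) * b0\<^sup>2 - (\<alpha> * a0\<^sup>2 + \<beta> * b0\<^sup>2) * b\<^sup>2"
      using that(1) n(1) by (intro dvd_diff dvd_mult2)
    also have "\<dots> = \<alpha> * ((a * b0 - a0 * b) * (a * b0 + a0 * b))"
      by (simp add: algebra_simps power2_eq_square)
    finally have dv: "n dvd (a * b0 - a0 * b) * (a * b0 + a0 * b)"
      using cop(1) by (simp add: coprime_dvd_mult_right_iff)
    have "g dvd a * b0 - a0 * b" using that(2) by (metis gcd_dvd2)
    then obtain q where q: "a * b0 - a0 * b = g * q" by blast
    have "gcd (g * h) (g * q) = g" using that(2) h q by simp
    then have "\<bar>g\<bar> * gcd h q = g" by (simp add: gcd_mult_distrib_int)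
    moreover have "0 \<le> g" by (simp add: g_def)
    ultimately have "coprime h q" using \<open>g \<noteq> 0\<close> by (simp add: coprime_iff_gcd_eq_1)
    moreover have "h dvd q * (a * b0 + a0 * b)"
      using dv \<open>g \<noteq> 0\<close> unfolding q h by (simp add: mult.assoc)
    ultimately show ?thesis by (simp add: coprime_dvd_mult_right_iff)
  qed
  have cg: "coprime g b0" and ch: "coprime h b0" using cop(2) h by auto
  \<comment> \<open>Both points have the ratio of the base point modulo \<open>g\<close>, and its
    negative modulo \<open>h\<close>. Eliminating the base point leaves \<open>b0\<close> times
    their own determinant, with the same sign in both cases.\<close>
  have "g dvd a1 * b0 - a0 * b1" "g dvd a2 * b0 - a0 * b2"
    unfolding g_def by simp (simp add: same)
  then have "g dvd b2 * (a1 * b0 - a0 * b1) - b1 * (a2 * b0 - a0 * b2)"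
    by (rule dvd_diff[OF dvd_mult dvd_mult])
  also have "\<dots> = b0 * ?D" by (simp add: algebra_simps)
  finally have gD: "g dvd ?D" using cg by (simp add: coprime_dvd_mult_right_iff)
  have "h dvd b2 * (a1 * b0 + a0 * b1) - b1 * (a2 * b0 + a0 * b2)"
    using h_dvd[OF n(2)] h_dvd[OF n(3)] same by (intro dvd_diff[OF dvd_mult dvd_mult]) (simp_all add: g_def)
  also have "\<dots> = b0 * ?D" by (simp add: algebra_simps)
  finally have hD: "h dvd ?D" using ch by (simp add: coprime_dvd_mult_right_iff)
  \<comment> \<open>\<open>g\<close> and \<open>h\<close> need not be coprime, but a common divisor
    divides difference and sum, hence 2 * a1 * b0, hence 2. This is the origin of the factor 2 in
    the conclusion.\<close>
  have "gcd g h dvd (a1 * b0 - a0 * b1) + (a1 * b0 + a0 * b1)"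
  proof (rule dvd_add)
    show "gcd g h dvd a1 * b0 - a0 * b1"
      by (rule dvd_trans[of _ g]) (simp, simp add: g_def)
    show "gcd g h dvd a1 * b0 + a0 * b1"
      by (rule dvd_trans[of _ h]) (simp, simp add: h_dvd[OF n(2)] g_def)
  qed
  then have "gcd g h dvd 2 * (a1 * b0)" by (simp add: algebra_simps)
  moreover have "coprime (gcd g h) (a1 * b0)"
  proof -
    have "gcd g h dvd n" unfolding h by (rule dvd_mult2) simp
    moreover have "coprime n (a1 * b0)" using cop by simp
    ultimately show ?thesis using coprime_divisors dvd_refl by blast
  qed
  ultimately have "gcd g h dvd 2" by (simp add: coprime_dvd_mult_left_iff)
  then have "gcd g h * lcm g h dvd 2 * ?D"
    using gD hD by (intro mult_dvd_mono lcm_least)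
  then have nD: "n dvd 2 * ?D"
    unfolding h using prod_gcd_lcm_int[of g h] by (metis abs_dvd_iff abs_mult)
  \<comment> \<open>Adding a multiple of the form at the first point turns the determinant into
    \<open>a1\<close> times the polar form, and \<open>a1\<close> is a unit modulo
    \<open>n\<close>.\<close>
  have "n dvd 2 * ?D * (\<beta> * b1) + (\<alpha> * a1\<^sup>2 + \<beta> * b1\<^sup>2) * (2 * a2)"
    by (rule dvd_add[OF dvd_mult2[OF nD] dvd_mult2[OF n(2)]])
  also have "\<dots> = a1 * (2 * (\<alpha> * a1 * a2 + \<beta> * b1 * b2))"
    by (simp add: algebra_simps power2_eq_square)
  finally show ?thesis using cop(3) by (simp add: coprime_dvd_mult_right_iff)
qed

lemma card_le_fibres:
  assumes "finite S" and q: "\<And>k. k \<in> f ` S \<Longrightarrow> real (card {s \<in> S. f s = k}) \<le> q"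
    and P: "real (card (f ` S)) \<le> P" and "0 \<le> q"
  shows "real (card S) \<le> P * q"
proof -
  have "S = (\<Union>k\<in>f ` S. {s \<in> S. f s = k})" by auto
  then have "card S \<le> (\<Sum>k\<in>f ` S. card {s \<in> S. f s = k})"
    using card_UN_le[of "f ` S" "\<lambda>k. {s \<in> S. f s = k}"] assms(1) by simp
  then have "real (card S) \<le> real (\<Sum>k\<in>f ` S. card {s \<in> S. f s = k})"
    by (rule of_nat_mono)
  also have "\<dots> = (\<Sum>k\<in>f ` S. real (card {s \<in> S. f s = k}))" by simp
  also have "\<dots> \<le> (\<Sum>k\<in>f ` S. q)" by (intro sum_mono q)
  also have "\<dots> \<le> P * q" using P \<open>0 \<le> q\<close> by (simp add: mult_right_mono)
  finally show ?thesis .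
qed

text \<open>Evaluate F = u x^2 + v y^2 - w z^2 at z' p - z p' for two zeros p, p': the last
  coordinate vanishes, which gives the right-hand side, and bilinearity leaves only the cross term,
  which gives the left.\<close>

lemma conic_polar_identity:
  fixes u v w :: "'a::comm_ring_1"
  assumes "u * x\<^sup>2 + v * y\<^sup>2 = w * z\<^sup>2" "u * x'\<^sup>2 + v * y'\<^sup>2 = w * z'\<^sup>2"
  shows "2 * (w * z * z' - u * x * x' - v * y * y') * (z * z') =
    u * (x * z' - x' * z)\<^sup>2 + v * (y * z' - y' * z)\<^sup>2"
proof -
  have "u * (x * z' - x' * z)\<^sup>2 + v * (y * z' - y' * z)\<^sup>2 =
      (u * x\<^sup>2 + v * y\<^sup>2) * z'\<^sup>2 + (u * x'\<^sup>2 + v * y'\<^sup>2) * z\<^sup>2 - 2 * (u * x * x' + v * y * y') * (z * z')"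
    by (simp add: algebra_simps power2_eq_square)
  also have "\<dots> = 2 * (w * z * z' - u * x * x' - v * y * y') * (z * z')"
    unfolding assms by (simp add: algebra_simps power2_eq_square)
  finally show ?thesis by simp
qed

text \<open>The polar form of the conic at two points of the same class is a multiple of \<open>u * v * w\<close> up to a
  factor 2, and by \<open>conic_polar_identity\<close> it is positive unless the points are proportional.\<close>

lemma conic_gap:
  fixes u v w x y z x' y' z' :: real
  assumes pos: "0 < u" "0 < v" "0 < w" "0 < x" "0 < y" "0 < z" "0 < x'" "0 < y'" "0 < z'"
    and eq: "u * x\<^sup>2 + v * y\<^sup>2 = w * z\<^sup>2" "u * x'\<^sup>2 + v * y'\<^sup>2 = w * z'\<^sup>2"
    and le: "u * x\<^sup>2 \<le> v * y\<^sup>2" "u * x'\<^sup>2 \<le> v * y'\<^sup>2"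
    and gap: "u * v * w \<le> 2 * (w * z * z' - u * x * x' - v * y * y')"
  shows "v * w * (z * z') \<le> 2 * (x * z' - x' * z)\<^sup>2"
proof -
  \<comment> \<open>Along the conic the two slopes move in opposite directions: u * d * Q = - v * e
    * P. As the y-term is the larger summand, u * Q^2 is at most v * P^2, hence v * e^2 is at most u
    * d^2, and the slope x / z alone carries the separation.\<close>
  define d e P Q where "d = x * z' - x' * z" and "e = y * z' - y' * z"
    and "P = y * z' + y' * z" and "Q = x * z' + x' * z"
  have P: "0 < P" using pos by (simp add: P_def add_pos_pos)
  have "(u * (x * x'))\<^sup>2 \<le> (v * (y * y'))\<^sup>2"
    using mult_mono[OF le] pos by (simp add: power2_eq_square mult_ac)
  then have xy: "u * (x * x') \<le> v * (y * y')"
    using pos by (intro power2_le_imp_le[of "u * (x * x')"]) auto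
  have "u * Q\<^sup>2 = (u * x\<^sup>2) * z'\<^sup>2 + (u * x'\<^sup>2) * z\<^sup>2 + 2 * (z * z') * (u * (x * x'))"
    by (simp add: Q_def algebra_simps power2_eq_square)
  also have "\<dots> \<le> (v * y\<^sup>2) * z'\<^sup>2 + (v * y'\<^sup>2) * z\<^sup>2 + 2 * (z * z') * (v * (y * y'))"
    using le xy pos by (intro add_mono mult_right_mono mult_left_mono) auto
  also have "\<dots> = v * P\<^sup>2"
    by (simp add: P_def algebra_simps power2_eq_square)
  finally have PQ: "u * Q\<^sup>2 \<le> v * P\<^sup>2" .
  have "u * (d * Q) + v * (e * P) = (u * x\<^sup>2 + v * y\<^sup>2) * z'\<^sup>2 - (u * x'\<^sup>2 + v * y'\<^sup>2) * z\<^sup>2"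
    by (simp add: d_def e_def P_def Q_def algebra_simps power2_eq_square)
  also have "\<dots> = 0" unfolding eq by simp
  finally have "v * (e * P) = - (u * (d * Q))" by simp
  then have "(v * (e * P))\<^sup>2 = (u * (d * Q))\<^sup>2" by simp
  then have "v * e\<^sup>2 * (v * P\<^sup>2) = u * d\<^sup>2 * (u * Q\<^sup>2)"
    by (simp add: power2_eq_square mult_ac)
  also have "\<dots> \<le> u * d\<^sup>2 * (v * P\<^sup>2)"
    using PQ pos by (intro mult_left_mono) auto
  finally have ed: "v * e\<^sup>2 \<le> u * d\<^sup>2"
    using P pos by (simp add: mult.commute)
  have "u * (v * w * (z * z')) = u * v * w * (z * z')" by simp
  also have "\<dots> \<le> 2 * (w * z * z' - u * x * x' - v * y * y') * (z * z')"
    using gap pos by (intro mult_right_mono) auto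
  also have "\<dots> = u * d\<^sup>2 + v * e\<^sup>2"
    unfolding d_def e_def by (rule conic_polar_identity[OF eq])
  also have "\<dots> \<le> u * (2 * d\<^sup>2)" using ed by simp
  finally show ?thesis using pos by (simp add: d_def)
qed

text \<open>The points are sorted into classes, as many as triples of divisors of the coefficients
  at most. Within a class \<open>conic_gap\<close> separates the slopes.\<close>

lemma conic_points_count:
  fixes S :: "(nat \<times> nat \<times> nat) set" and u v w X Y Z :: nat
  assumes "finite S"
    and box: "\<And>x y z. (x, y, z) \<in> S \<Longrightarrow>
      0 < x \<and> x \<le> X \<and> 0 < y \<and> y \<le> Y \<and> 0 < z \<and> z \<le> Z \<and> Z \<le> 2 * z"
    and pos: "0 < u" "0 < v" "0 < w"
    and sol: "\<And>x y z. (x, y, z) \<in> S \<Longrightarrow>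
      u * x\<^sup>2 + v * y\<^sup>2 = w * z\<^sup>2 \<and> u * x\<^sup>2 \<le> v * y\<^sup>2 \<and> coprime (u * x\<^sup>2) (v * y\<^sup>2)"
    and mem: "(x0, y0, z0) \<in> S"
  shows "real (card S) \<le> real (card {d. d dvd u} * (card {d. d dvd v} * card {d. d dvd w})) *
    (1 + 4 * (real X * real Y * real Z) / real (w * z0\<^sup>2))"
proof -
  note b0 = box[OF mem]
  have Z: "0 < Z" and Y: "0 < Y" using b0 by auto
  \<comment> \<open>Modulo each coefficient the equation is a binary form in the two other
    variables, to which \<open>conic_congruence\<close> applies with the given point as
    base.\<close>
  define cls where "cls = (\<lambda>(x, y, z). (nat (gcd (int u) (int y * int z0 - int y0 * int z)),
     nat (gcd (int v) (int x * int z0 - int x0 * int z)),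
     nat (gcd (int w) (int x * int y0 - int x0 * int y))))"
  \<comment> \<open>\<open>conic_gap\<close> bounds the squared determinant below by v * w * z * z'
    / 2. Dividing by (z * z')^2 and using z * z' \<le> Z^2 leaves the square of
    \<open>h\<close>.\<close>
  define h where "h = sqrt (real v * real w / 2) / real Z"
  have h: "0 < h" using Z pos by (simp add: h_def)
  have cop: "coprime u v" "coprime u w" "coprime v w" "coprime u y" "coprime u z" "coprime v x"
      "coprime v z" "coprime w x" "coprime w y" "coprime x z"
    if "(x, y, z) \<in> S" for x y z
    using coprime_summands[of "u * x\<^sup>2" "v * y\<^sup>2" "w * z\<^sup>2"] sol[OF that]
    by (auto simp: coprime_commute)
  have eqi: "int u * (int x)\<^sup>2 + int v * (int y)\<^sup>2 = int w * (int z)\<^sup>2"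
    if "(x, y, z) \<in> S" for x y z
  proof -
    have "int (u * x\<^sup>2 + v * y\<^sup>2) = int (w * z\<^sup>2)" using sol[OF that] by simp
    then show ?thesis by simp
  qed
  have eqr: "real u * (real x)\<^sup>2 + real v * (real y)\<^sup>2 = real w * (real z)\<^sup>2"
    and ler: "real u * (real x)\<^sup>2 \<le> real v * (real y)\<^sup>2"
    if "(x, y, z) \<in> S" for x y z
  proof -
    have "real (u * x\<^sup>2 + v * y\<^sup>2) = real (w * z\<^sup>2)" using sol[OF that] by simp
    then show "real u * (real x)\<^sup>2 + real v * (real y)\<^sup>2 = real w * (real z)\<^sup>2" by simp
    have "real (u * x\<^sup>2) \<le> real (v * y\<^sup>2)" using sol[OF that] by (simp only: of_nat_le_iff)
    then show "real u * (real x)\<^sup>2 \<le> real v * (real y)\<^sup>2" by simp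
  qed
  have sep: "h * (real z * real z') \<le> \<bar>real x * real z' - real x' * real z\<bar>"
    if p: "(x, y, z) \<in> S" "(x', y', z') \<in> S" "(x, y, z) \<noteq> (x', y', z')"
      and same: "cls (x, y, z) = cls (x', y', z')" for x y z x' y' z'
  proof -
    note b = box[OF p(1)] and b' = box[OF p(2)]
    let ?d = "int x * int z' - int x' * int z"
    define B where "B = int w * int z * int z' - int u * int x * int x' - int v * int y * int y'"
    have ne: "?d \<noteq> 0"
    proof
      assume "?d = 0"
      then have "int (x * z') = int (x' * z)" by simp
      then have e: "x * z' = x' * z" by (simp only: of_nat_eq_iff)
      have "x dvd x' * z" "x' dvd x * z'" unfolding e[symmetric] by simp (simp add: e)
      then have "x dvd x'" "x' dvd x"
        using cop(10)[OF p(1)] cop(10)[OF p(2)] by (simp_all add: coprime_dvd_mult_left_iff)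
      then have x: "x = x'" by (rule dvd_antisym)
      then have z: "z = z'" using e b by auto
      have "u * x'\<^sup>2 + v * y\<^sup>2 = u * x'\<^sup>2 + v * y'\<^sup>2"
        using sol[OF p(1)] sol[OF p(2)] x z by simp
      then have "y = y'" using pos by simp
      then show False using x z p(3) by simp
    qed
    have form: "int v * (int y)\<^sup>2 + - int w * (int z)\<^sup>2 = int u * (- (int x)\<^sup>2)"
        "int u * (int x)\<^sup>2 + - int w * (int z)\<^sup>2 = int v * (- (int y)\<^sup>2)"
        "int u * (int x)\<^sup>2 + int v * (int y)\<^sup>2 = int w * (int z)\<^sup>2"
      if "(x, y, z) \<in> S" for x y z
      using eqi[OF that] by simp_all
    have dvdu: "int u dvd int v * (int y)\<^sup>2 + - int w * (int z)\<^sup>2"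
      and dvdv: "int v dvd int u * (int x)\<^sup>2 + - int w * (int z)\<^sup>2"
      and dvdw: "int w dvd int u * (int x)\<^sup>2 + int v * (int y)\<^sup>2"
      if "(x, y, z) \<in> S" for x y z
      unfolding form[OF that] by simp_all
    have same': "gcd (int u) (int y * int z0 - int y0 * int z) = gcd (int u) (int y' * int z0 - int y0 * int z')"
      "gcd (int v) (int x * int z0 - int x0 * int z) = gcd (int v) (int x' * int z0 - int x0 * int z')"
      "gcd (int w) (int x * int y0 - int x0 * int y) = gcd (int w) (int x' * int y0 - int x0 * int y')"
      using same by (simp_all add: cls_def eq_nat_nat_iff)
    have copi: "coprime (int u) (int v)" "coprime (int v) (int u)" "coprime (int w) (int u)"
        "coprime (int u) (int z0)" "coprime (int v) (int z0)" "coprime (int w) (int y0)"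
        "coprime (int u) (int y)" "coprime (int v) (int x)" "coprime (int w) (int x)"
      using cop[OF mem] cop[OF p(1)] by (simp_all add: coprime_commute)
    have "int u dvd 2 * (int v * int y * int y' + (- int w) * int z * int z')"
      using dvdu[OF mem] dvdu[OF p(1)] dvdu[OF p(2)] copi(1) copi(4) copi(7) same'(1)
      by (rule conic_congruence) (use pos in simp)
    then have "int u dvd int u * (- 2 * int x * int x') - 2 * (int v * int y * int y' + (- int w) * int z * int z')"
      by (intro dvd_diff) auto
    also have "\<dots> = 2 * B" by (simp add: B_def algebra_simps)
    finally have Bu: "int u dvd 2 * B" .
    have "int v dvd 2 * (int u * int x * int x' + (- int w) * int z * int z')"
      using dvdv[OF mem] dvdv[OF p(1)] dvdv[OF p(2)] copi(2) copi(5) copi(8) same'(2)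
      by (rule conic_congruence) (use pos in simp)
    then have "int v dvd int v * (- 2 * int y * int y') - 2 * (int u * int x * int x' + (- int w) * int z * int z')"
      by (intro dvd_diff) auto
    also have "\<dots> = 2 * B" by (simp add: B_def algebra_simps)
    finally have Bv: "int v dvd 2 * B" .
    have "int w dvd 2 * (int u * int x * int x' + int v * int y * int y')"
      using dvdw[OF mem] dvdw[OF p(1)] dvdw[OF p(2)] copi(3) copi(6) copi(9) same'(3)
      by (rule conic_congruence) (use pos in simp)
    then have "int w dvd int w * (2 * int z * int z') - 2 * (int u * int x * int x' + int v * int y * int y')"
      by (intro dvd_diff) auto
    also have "\<dots> = 2 * B" by (simp add: B_def algebra_simps)
    finally have Bw: "int w dvd 2 * B" .
    \<comment> \<open>The coefficients are pairwise coprime, so the three congruences combine.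
      Positivity of \<open>B\<close>, from the polar identity at distinct points, turns the
      divisibility into a lower bound.\<close>
    have "int u * int v * int w dvd 2 * B"
      using Bu Bv Bw cop[OF mem] by (intro divides_mult) auto
    moreover have B0: "0 < 2 * B"
    proof -
      have "2 * B * (int z * int z') = int u * ?d\<^sup>2 + int v * (int y * int z' - int y' * int z)\<^sup>2"
        unfolding B_def by (rule conic_polar_identity[OF eqi[OF p(1)] eqi[OF p(2)]])
      also have "\<dots> > 0" using ne pos by (intro add_pos_nonneg) auto
      finally have "0 < 2 * B * (int z * int z')" .
      moreover have "0 < int z * int z'" using b b' by simp
      ultimately show ?thesis using zero_less_mult_pos2 by blast
    qed
    ultimately have "int u * int v * int w \<le> 2 * B" by (rule zdvd_imp_le)
    then have "real_of_int (int u * int v * int w) \<le> real_of_int (2 * B)"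
      by (simp only: of_int_le_iff)
    then have "real u * real v * real w \<le> 2 * (real w * real z * real z' - real u * real x * real x' - real v * real y * real y')"
      by (simp add: B_def)
    then have gap: "real v * real w * (real z * real z') \<le> 2 * (real x * real z' - real x' * real z)\<^sup>2"
      using pos b b' by (intro conic_gap[OF _ _ _ _ _ _ _ _ _ eqr[OF p(1)] eqr[OF p(2)] ler[OF p(1)] ler[OF p(2)]]) auto
    have "(h * (real z * real z'))\<^sup>2 = (real v * real w / 2) * ((real z * real z')\<^sup>2 / (real Z)\<^sup>2)"
      by (simp add: h_def power_mult_distrib power_divide)
    also have "\<dots> \<le> (real v * real w / 2) * (real z * real z')"
    proof (intro mult_left_mono)
      have "(real z * real z')\<^sup>2 \<le> (real z * real z') * (real Z * real Z)"
        unfolding power2_eq_square using b b' by (intro mult_left_mono mult_mono) auto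
      then show "(real z * real z')\<^sup>2 / (real Z)\<^sup>2 \<le> real z * real z'"
        using Z by (simp add: pos_divide_le_eq power2_eq_square)
    qed auto
    also have "\<dots> \<le> \<bar>real x * real z' - real x' * real z\<bar>\<^sup>2" using gap by simp
    finally show ?thesis by (rule power2_le_imp_le) simp
  qed
  have "real (card S) \<le> real (card {d. d dvd u} * (card {d. d dvd v} * card {d. d dvd w})) *
      (1 + 2 * real X / (real Z * h))"
  proof (rule card_le_fibres[OF assms(1), where f = cls])
    fix k assume "k \<in> cls ` S"
    show "real (card {s \<in> S. cls s = k}) \<le> 1 + 2 * real X / (real Z * h)"
    proof (rule card_separated_fractions_le[OF _ Z h])
      show "finite {s \<in> S. cls s = k}" using assms(1) by simp
      show "x \<le> X \<and> 0 < z \<and> Z \<le> 2 * z" if "(x, y, z) \<in> {s \<in> S. cls s = k}" for x y z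
        using box[of x y z] that by simp
      show "h * (real z * real z') \<le> \<bar>real x * real z' - real x' * real z\<bar>"
        if "(x, y, z) \<in> {s \<in> S. cls s = k}" "(x', y', z') \<in> {s \<in> S. cls s = k}"
          "(x, y, z) \<noteq> (x', y', z')" for x y z x' y' z'
      proof (rule sep[OF _ _ that(3)])
        show "(x, y, z) \<in> S" "(x', y', z') \<in> S" using that by simp_all
        show "cls (x, y, z) = cls (x', y', z')" using that(1,2) by (simp only: mem_Collect_eq)
      qed
    qed
  next
    have "cls ` S \<subseteq> {d. d dvd u} \<times> {d. d dvd v} \<times> {d. d dvd w}"
    proof
      fix k assume "k \<in> cls ` S"
      then obtain x y z where "k = cls (x, y, z)" by auto
      moreover have "nat (gcd (int n) m) dvd n" for n m
      proof -
        have "int (nat (gcd (int n) m)) dvd int n" by simp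
        then show ?thesis by (simp only: int_dvd_int_iff)
      qed
      ultimately show "k \<in> {d. d dvd u} \<times> {d. d dvd v} \<times> {d. d dvd w}"
        by (simp add: cls_def)
    qed
    then have "card (cls ` S) \<le> card ({d. d dvd u} \<times> {d. d dvd v} \<times> {d. d dvd w})"
      using pos by (intro card_mono) (auto intro!: finite_divisors_nat)
    then show "real (card (cls ` S)) \<le> real (card {d. d dvd u} * (card {d. d dvd v} * card {d. d dvd w}))"
      by (simp only: card_cartesian_product of_nat_le_iff)
  qed (use h in auto)
  also have "\<dots> \<le> real (card {d. d dvd u} * (card {d. d dvd v} * card {d. d dvd w})) *
    (1 + 4 * (real X * real Y * real Z) / real (w * z0\<^sup>2))"
  proof (intro mult_left_mono add_left_mono)
    \<comment> \<open>The sum is bounded twice, through its larger summand and through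
      \<open>z0 \<le> Z\<close>; the product of both bounds contains v * w, the quantity under the
      root in \<open>h\<close>.\<close>
    have "w * z0\<^sup>2 \<le> 2 * (v * y0\<^sup>2)" using sol[OF mem] by linarith
    also have "\<dots> \<le> 2 * (v * Y\<^sup>2)" using b0 by simp
    finally have 1: "real (w * z0\<^sup>2) \<le> real (2 * (v * Y\<^sup>2))" by (rule of_nat_mono)
    have 2: "real (w * z0\<^sup>2) \<le> real (w * Z\<^sup>2)" using b0 by (intro of_nat_mono) simp
    have "(real (w * z0\<^sup>2))\<^sup>2 \<le> real (2 * (v * Y\<^sup>2)) * real (w * Z\<^sup>2)"
      unfolding power2_eq_square[of "real (w * z0\<^sup>2)"] using 1 2 by (intro mult_mono) auto
    also have "\<dots> = (2 * real Y * real Z * sqrt (real v * real w / 2))\<^sup>2"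
      by (simp add: power_mult_distrib)
    finally have 3: "real (w * z0\<^sup>2) \<le> 2 * real Y * real Z * sqrt (real v * real w / 2)"
      by (rule power2_le_imp_le) simp
    have "2 * real X / (real Z * h) = 2 * real X / sqrt (real v * real w / 2)"
      using Z by (simp add: h_def)
    also have "\<dots> \<le> 4 * (real X * real Y * real Z) / real (w * z0\<^sup>2)"
    proof -
      have "2 * real X * real (w * z0\<^sup>2) \<le> 2 * real X * (2 * real Y * real Z * sqrt (real v * real w / 2))"
        using 3 by (intro mult_left_mono) auto
      moreover have s: "0 < sqrt (real v * real w / 2)" and c: "0 < real (w * z0\<^sup>2)"
        using pos b0 by auto
      ultimately show ?thesis
        unfolding pos_divide_le_eq[OF s] times_divide_eq_left pos_le_divide_eq[OF c]
        by (simp only: mult_ac)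
    qed
    finally show "2 * real X / (real Z * h) \<le> 4 * (real X * real Y * real Z) / real (w * z0\<^sup>2)" .
  qed simp
  finally show ?thesis .
qed

section \<open>Counting in dyadic boxes\<close>

definition cap :: "nat \<Rightarrow> nat" where
  "cap n = 2 * 2 ^ floor_log n"

lemma cap_ge: "n \<le> cap n"
  unfolding cap_def by (rule floor_log_exp2_ge)

lemma cap_le: "0 < n \<Longrightarrow> cap n \<le> 2 * n"
  using floor_log_exp2_le[of n] by (simp add: cap_def)

text \<open>The label of the dyadic box of an integer, given by its upper corner.\<close>

definition caps :: "nat \<Rightarrow> nat \<times> nat \<times> nat" where
  "caps n = (cap (simple_part n), cap (double_part n), cap (rad (cubefull_part n)))"

lemma caps_rad_le:
  assumes "0 < n" "caps n = (X1, X2, X3)"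
  shows "X1 * X2 * X3 \<le> 8 * rad n"
proof -
  have "X1 * X2 * X3 \<le> (2 * simple_part n) * (2 * double_part n) * (2 * rad (cubefull_part n))"
    using assms parts_pos[OF assms(1)] by (intro mult_le_mono) (auto simp: caps_def cap_le rad_pos)
  also have "\<dots> = 8 * rad n" unfolding parts_rad[of n, symmetric] by simp
  finally show ?thesis .
qed

text \<open>64 is 2 * 2^2 * 2^3, one factor 2 for each rounding up.\<close>

lemma caps_le:
  assumes "0 < n" "caps n = (X1, X2, X3)"
  shows "X1 * X2\<^sup>2 * X3 ^ 3 \<le> 64 * n"
proof -
  have "X1 * X2\<^sup>2 * X3 ^ 3 \<le>
      (2 * simple_part n) * (2 * double_part n)\<^sup>2 * (2 * rad (cubefull_part n)) ^ 3"
    using assms parts_pos[OF assms(1)]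
    by (intro mult_le_mono power_mono) (auto simp: caps_def cap_le rad_pos)
  also have "\<dots> = 64 * (simple_part n * (double_part n)\<^sup>2 * rad (cubefull_part n) ^ 3)"
    by (simp add: power_mult_distrib)
  also have "\<dots> \<le> 64 * (simple_part n * (double_part n)\<^sup>2 * cubefull_part n)"
    by (intro mult_le_mono order_refl rad_cubefull_part_cube_le)
  also have "\<dots> = 64 * n" unfolding parts_mult[OF assms(1)] ..
  finally show ?thesis .
qed

lemma parts_le:
  assumes "0 < n"
  shows "simple_part n \<le> n" "double_part n \<le> n" "cubefull_part n \<le> n"
proof -
  let ?m = "simple_part n * (double_part n)\<^sup>2 * cubefull_part n"
  have "simple_part n dvd ?m" "double_part n dvd ?m" "cubefull_part n dvd ?m"
    by (simp_all add: power2_eq_square)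
  then have d: "simple_part n dvd n" "double_part n dvd n" "cubefull_part n dvd n"
    unfolding parts_mult[OF assms] by this+
  show "simple_part n \<le> n" "double_part n \<le> n" "cubefull_part n \<le> n"
    using d assms by (auto intro: dvd_imp_le)
qed

text \<open>The third entry is \<open>A + B\<close>. The order makes \<open>B\<close> at least half
  of it, the inequality on which both point counts rest.\<close>

definition ordered_pairs :: "real \<Rightarrow> real \<Rightarrow> real \<Rightarrow> nat \<Rightarrow> (nat \<times> nat) set" where
  "ordered_pairs a b c N = {(A, B). 0 < A \<and> A \<le> B \<and> A + B \<le> N \<and> coprime A B \<and>
     real (rad A) \<le> real A powr a \<and> real (rad B) \<le> real B powr b \<and>
     real (rad (A + B)) \<le> real (A + B) powr c}"

lemma finite_ordered_pairs: "finite (ordered_pairs a b c N)"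
  by (rule finite_subset[of _ "{..N} \<times> {..N}"]) (auto simp: ordered_pairs_def)

text \<open>Counts the lines as well as the conics: \<open>U\<close>, \<open>V\<close>,
  \<open>W\<close> bound the double parts for the former and the simple parts for the latter. Each
  of the three cube-full parts is counted through its radical at the price of one
  \<open>E\<close>.\<close>

lemma fixed_parts_count:
  fixes E :: real
  assumes E: "0 \<le> E" "\<And>R. real (card {m. 0 < m \<and> m \<le> N \<and> rad m \<le> R}) \<le> real R * E"
    and sub: "F \<subseteq> {1..U} \<times> {m. 0 < m \<and> m \<le> N \<and> rad m \<le> U'} \<times>
      {1..V} \<times> {m. 0 < m \<and> m \<le> N \<and> rad m \<le> V'} \<times>
      {1..W} \<times> {m. 0 < m \<and> m \<le> N \<and> rad m \<le> W'}"
  shows "real (card F) \<le> E ^ 3 * (real U * real U' * real V * real V' * real W * real W')"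
proof -
  let ?M = "\<lambda>R. {m. 0 < m \<and> m \<le> N \<and> rad m \<le> R}"
  have fin: "finite (?M R)" for R
    by (rule finite_subset[of _ "{..N}"]) auto
  have "card F \<le> card ({1..U} \<times> ?M U' \<times> {1..V} \<times> ?M V' \<times> {1..W} \<times> ?M W')"
    using sub fin by (intro card_mono finite_cartesian_product) auto
  then have "real (card F) \<le> real (U * (card (?M U') * (V * (card (?M V') * (W * card (?M W'))))))"
    by (simp only: card_cartesian_product card_atLeastAtMost of_nat_le_iff) simp
  also have "\<dots> \<le> real U * ((real U' * E) * (real V * ((real V' * E) * (real W * (real W' * E)))))"
    unfolding of_nat_mult using E by (intro mult_mono mult_nonneg_nonneg) auto
  also have "\<dots> = E ^ 3 * (real U * real U' * real V * real V' * real W * real W')"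
    by (simp add: power3_eq_cube mult_ac)
  finally show ?thesis .
qed

text \<open>Meant for the exponent \<open>a + b + c - 1\<close>, which may be negative; the power is
  then at most 1.\<close>

lemma powr_le_add_one:
  assumes "1 \<le> C" "C \<le> N"
  shows "C powr t \<le> N powr t + (1::real)"
proof (cases "0 \<le> t")
  case True
  then have "C powr t \<le> N powr t" using assms by (intro powr_mono2) auto
  then show ?thesis by simp
next
  case False
  then have "C powr t \<le> C powr 0" using assms by (intro powr_mono) auto
  then show ?thesis using assms by (simp add: add.commute add_increasing2)
qed

lemma box_count:
  fixes E :: real
  assumes abc: "0 < a" "0 < b" "0 < c"
    and S: "S \<subseteq> ordered_pairs a b c N"
    and caps: "\<And>A B. (A, B) \<in> S \<Longrightarrow>
      caps A = (X1, X2, X3) \<and> caps B = (Y1, Y2, Y3) \<and> caps (A + B) = (Z1, Z2, Z3)"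
    and E: "1 \<le> E"
    and divE: "\<And>n. 0 < n \<Longrightarrow> n \<le> N \<Longrightarrow> real (card {d. d dvd n}) \<le> E"
    and radE: "\<And>R. real (card {m. 0 < m \<and> m \<le> N \<and> rad m \<le> R}) \<le> real R * E"
    and ne: "S \<noteq> {}"
  shows "real (card S) \<le> E ^ 6 * (64 * real N + 2048 * (real N powr (a + b + c - 1) + 1))"
proof -
  define G where "G = real N powr (a + b + c - 1) + 1"
  define P where "P = real X2 * real X3 * real Y2 * real Y3 * real Z2 * real Z3"
  define Q where "Q = real X1 * real X3 * real Y1 * real Y3 * real Z1 * real Z3"
  have G: "1 \<le> G" by (simp add: G_def)
  have fin: "finite S" using S finite_ordered_pairs finite_subset by blast
  have mem: "0 < A" "A \<le> B" "A + B \<le> N" "coprime A B" if "(A, B) \<in> S" for A B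
    using S that by (auto simp: ordered_pairs_def)
  have cap_parts: "simple_part A \<le> X1" "double_part A \<le> X2" "rad (cubefull_part A) \<le> X3"
     "simple_part B \<le> Y1" "double_part B \<le> Y2" "rad (cubefull_part B) \<le> Y3"
     "simple_part (A + B) \<le> Z1" "double_part (A + B) \<le> Z2" "rad (cubefull_part (A + B)) \<le> Z3"
     "Z1 \<le> 2 * simple_part (A + B)" "Z2 \<le> 2 * double_part (A + B)"
    if "(A, B) \<in> S" for A B
    using caps[OF that] cap_ge cap_le parts_pos[of "A + B"] mem(1)[OF that]
    by (auto simp: caps_def)
  have capsA: "caps A = (X1, X2, X3)" and capsB: "caps B = (Y1, Y2, Y3)"
    and capsC: "caps (A + B) = (Z1, Z2, Z3)" if "(A, B) \<in> S" for A B
    using caps[OF that] by simp_all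
  have pos: "0 < X1" "0 < X2" "0 < X3" "0 < Y1" "0 < Y2" "0 < Y3" "0 < Z1" "0 < Z2" "0 < Z3"
    using ne caps by (auto simp: caps_def cap_def)
  \<comment> \<open>The product of all nine caps is at most 8^3 times the three radicals, all of
    them bounded by powers of \<open>A + B\<close>. One power of \<open>A + B\<close> is split off,
    since the point counts divide by it.\<close>
  have ratio: "real X1 * real Y1 * real Z1 * P \<le> 512 * G * real (A + B)"
    if AB: "(A, B) \<in> S" for A B
  proof -
    have C: "1 \<le> real (A + B)" "real (A + B) \<le> real N" using mem[OF AB] by linarith+
    have x: "real X1 * real X2 * real X3 \<le> 8 * real (A + B) powr a"
    proof -
      have "X1 * X2 * X3 \<le> 8 * rad A" by (rule caps_rad_le[OF mem(1)[OF AB] capsA[OF AB]])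
      then have "real (X1 * X2 * X3) \<le> real (8 * rad A)" by (rule of_nat_mono)
      moreover have "real (rad A) \<le> real A powr a" using S AB by (auto simp: ordered_pairs_def)
      moreover have "real A powr a \<le> real (A + B) powr a" using abc by (intro powr_mono2) auto
      ultimately show ?thesis by simp
    qed
    have y: "real Y1 * real Y2 * real Y3 \<le> 8 * real (A + B) powr b"
    proof -
      have "0 < B" using mem[OF AB] by simp
      then have "Y1 * Y2 * Y3 \<le> 8 * rad B" by (rule caps_rad_le[OF _ capsB[OF AB]])
      then have "real (Y1 * Y2 * Y3) \<le> real (8 * rad B)" by (rule of_nat_mono)
      moreover have "real (rad B) \<le> real B powr b" using S AB by (auto simp: ordered_pairs_def)
      moreover have "real B powr b \<le> real (A + B) powr b" using abc by (intro powr_mono2) auto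
      ultimately show ?thesis by simp
    qed
    have z: "real Z1 * real Z2 * real Z3 \<le> 8 * real (A + B) powr c"
    proof -
      have "0 < A + B" using mem[OF AB] by simp
      then have "Z1 * Z2 * Z3 \<le> 8 * rad (A + B)" by (rule caps_rad_le[OF _ capsC[OF AB]])
      then have "real (Z1 * Z2 * Z3) \<le> real (8 * rad (A + B))" by (rule of_nat_mono)
      moreover have "real (rad (A + B)) \<le> real (A + B) powr c" using S AB by (auto simp: ordered_pairs_def)
      ultimately show ?thesis by simp
    qed
    have "real X1 * real Y1 * real Z1 * P =
        (real X1 * real X2 * real X3) * ((real Y1 * real Y2 * real Y3) * (real Z1 * real Z2 * real Z3))"
      by (simp add: P_def mult_ac)
    also have "\<dots> \<le> (8 * real (A + B) powr a) * ((8 * real (A + B) powr b) * (8 * real (A + B) powr c))"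
      by (intro mult_mono x y z) auto
    also have "\<dots> = 512 * (real (A + B) powr (a + b + c - 1) * real (A + B))"
      using C by (simp add: powr_add powr_diff)
    also have "\<dots> \<le> 512 * (G * real (A + B))"
      unfolding G_def using powr_le_add_one[OF C] by (intro mult_left_mono mult_right_mono) auto
    finally show ?thesis by simp
  qed
  have linear: "real (card S) \<le> E ^ 3 * (P + 2048 * G)"
  proof -
    define f where "f = (\<lambda>(A, B). (double_part A, cubefull_part A, double_part B, cubefull_part B,
       double_part (A + B), cubefull_part (A + B)))"
    have P: "0 < P" using pos by (simp add: P_def)
    \<comment> \<open>2048 is 4 * 512: the constant of the point count times that of
      \<open>ratio\<close>.\<close>
    have "real (card S) \<le> (E ^ 3 * P) * (1 + 2048 * G / P)"
    proof (rule card_le_fibres[OF fin, where f = f])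
      fix k assume "k \<in> f ` S"
      then obtain A0 B0 where 0: "(A0, B0) \<in> S" "k = f (A0, B0)" by auto
      let ?F = "{s \<in> S. f s = k}"
      let ?g = "\<lambda>(A, B). (simple_part A, simple_part B, simple_part (A + B))"
      let ?u = "(double_part A0)\<^sup>2 * cubefull_part A0" and ?v = "(double_part B0)\<^sup>2 * cubefull_part B0"
        and ?w = "(double_part (A0 + B0))\<^sup>2 * cubefull_part (A0 + B0)"
      have eq: "?u * simple_part A = A" "?v * simple_part B = B" "?w * simple_part (A + B) = A + B"
        if "(A, B) \<in> ?F" for A B
        using that mem[of A B] 0 parts_mult[of A] parts_mult[of B] parts_mult[of "A + B"]
        by (auto simp: f_def mult_ac)
      have inj: "inj_on ?g ?F"
      proof (rule inj_onI)
        fix s t assume st: "s \<in> ?F" "t \<in> ?F" "?g s = ?g t"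
        obtain A B A' B' where AB: "s = (A, B)" "t = (A', B')" by fastforce
        show "s = t"
          using eq(1,2)[OF st(1)[unfolded AB]] eq(1,2)[OF st(2)[unfolded AB]] st(3)
          unfolding AB by (metis case_prod_conv prod.inject)
      qed
      have cnt: "real (card (?g ` ?F)) \<le> 1 + 4 * (real X1 * real Y1 * real Z1) / real (?w * simple_part (A0 + B0))"
      proof (rule linear_points_count)
        show "finite (?g ` ?F)" using fin by simp
        show "(simple_part A0, simple_part B0, simple_part (A0 + B0)) \<in> ?g ` ?F"
          by (rule image_eqI[of _ _ "(A0, B0)"]) (use 0 in simp_all)
        show "0 < ?u" "0 < ?v" "0 < ?w"
          using mem[OF 0(1)] parts_pos[of A0] parts_pos[of B0] parts_pos[of "A0 + B0"] by auto
        fix x y z assume "(x, y, z) \<in> ?g ` ?F"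
        then obtain A B where AB: "(A, B) \<in> ?F"
          and xyz: "x = simple_part A" "y = simple_part B" "z = simple_part (A + B)" by auto
        then have AB': "(A, B) \<in> S" by simp
        show "0 < x \<and> x \<le> X1 \<and> 0 < y \<and> y \<le> Y1 \<and> 0 < z \<and> z \<le> Z1 \<and> Z1 \<le> 2 * z"
          using mem[OF AB'] parts_pos[of A] parts_pos[of B] parts_pos[of "A + B"] cap_parts[OF AB']
          by (simp add: xyz)
        show "?u * x + ?v * y = ?w * z \<and> ?u * x \<le> ?v * y \<and> coprime (?u * x) (?v * y)"
          unfolding xyz eq[OF AB] using mem[OF AB'] by simp
      qed
      have w: "?w * simple_part (A0 + B0) = A0 + B0" using eq(3)[of A0 B0] 0 by simp
      have c: "0 < real (A0 + B0)" using mem(1)[OF 0(1)] by simp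
      have "4 * (real X1 * real Y1 * real Z1) / real (A0 + B0) \<le> 2048 * G / P"
        unfolding pos_divide_le_eq[OF c] times_divide_eq_left pos_le_divide_eq[OF P]
        using mult_left_mono[OF ratio[OF 0(1)], of 4] by simp
      then show "real (card ?F) \<le> 1 + 2048 * G / P"
        using cnt unfolding w card_image[OF inj] by linarith
    next
      show "real (card (f ` S)) \<le> E ^ 3 * P"
        unfolding P_def
      proof (rule fixed_parts_count[OF _ radE])
        show "f ` S \<subseteq> {1..X2} \<times> {m. 0 < m \<and> m \<le> N \<and> rad m \<le> X3} \<times>
          {1..Y2} \<times> {m. 0 < m \<and> m \<le> N \<and> rad m \<le> Y3} \<times>
          {1..Z2} \<times> {m. 0 < m \<and> m \<le> N \<and> rad m \<le> Z3}"
        proof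
          fix k assume "k \<in> f ` S"
          then obtain A B where AB: "(A, B) \<in> S" "k = f (A, B)" by auto
          have "0 < A" "0 < B" "0 < A + B" "A \<le> N" "B \<le> N" "A + B \<le> N" using mem[OF AB(1)] by auto
          then show "k \<in> {1..X2} \<times> {m. 0 < m \<and> m \<le> N \<and> rad m \<le> X3} \<times>
            {1..Y2} \<times> {m. 0 < m \<and> m \<le> N \<and> rad m \<le> Y3} \<times>
            {1..Z2} \<times> {m. 0 < m \<and> m \<le> N \<and> rad m \<le> Z3}"
            using cap_parts[OF AB(1)] parts_pos[of A] parts_pos[of B] parts_pos[of "A + B"]
              parts_le[of A] parts_le[of B] parts_le[of "A + B"]
            by (simp add: AB(2) f_def Suc_le_eq)
        qed
      qed (use E in simp)
    qed (use G P in simp)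
    moreover have "P * (1 + 2048 * G / P) = P + 2048 * G" using P by (simp add: distrib_left)
    ultimately show ?thesis by (simp only: mult.assoc)
  qed
  have conic: "real (card S) \<le> E ^ 6 * (Q + 2048 * G)"
  proof -
    define f where "f = (\<lambda>(A, B). (simple_part A, cubefull_part A, simple_part B, cubefull_part B,
       simple_part (A + B), cubefull_part (A + B)))"
    have Q: "0 < Q" using pos by (simp add: Q_def)
    \<comment> \<open>Three factors \<open>E\<close> come from the cube-full parts, three more from
      the divisors of the coefficients.\<close>
    have "real (card S) \<le> (E ^ 3 * Q) * (E ^ 3 * (1 + 2048 * G / Q))"
    proof (rule card_le_fibres[OF fin, where f = f])
      fix k assume "k \<in> f ` S"
      then obtain A0 B0 where 0: "(A0, B0) \<in> S" "k = f (A0, B0)" by auto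
      let ?F = "{s \<in> S. f s = k}"
      let ?g = "\<lambda>(A, B). (double_part A, double_part B, double_part (A + B))"
      let ?u = "simple_part A0 * cubefull_part A0" and ?v = "simple_part B0 * cubefull_part B0"
        and ?w = "simple_part (A0 + B0) * cubefull_part (A0 + B0)"
      have eq: "?u * (double_part A)\<^sup>2 = A" "?v * (double_part B)\<^sup>2 = B"
          "?w * (double_part (A + B))\<^sup>2 = A + B"
        if "(A, B) \<in> ?F" for A B
        using that mem[of A B] 0 parts_mult[of A] parts_mult[of B] parts_mult[of "A + B"]
        by (auto simp: f_def mult_ac)
      have inj: "inj_on ?g ?F"
      proof (rule inj_onI)
        fix s t assume st: "s \<in> ?F" "t \<in> ?F" "?g s = ?g t"
        obtain A B A' B' where AB: "s = (A, B)" "t = (A', B')" by fastforce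
        show "s = t"
          using eq(1,2)[OF st(1)[unfolded AB]] eq(1,2)[OF st(2)[unfolded AB]] st(3)
          unfolding AB by (metis case_prod_conv prod.inject)
      qed
      have uvw: "0 < ?u" "0 < ?v" "0 < ?w"
        using mem[OF 0(1)] parts_pos[of A0] parts_pos[of B0] parts_pos[of "A0 + B0"] by auto
      have cnt: "real (card (?g ` ?F)) \<le>
          real (card {d. d dvd ?u} * (card {d. d dvd ?v} * card {d. d dvd ?w})) *
          (1 + 4 * (real X2 * real Y2 * real Z2) / real (?w * (double_part (A0 + B0))\<^sup>2))"
      proof (rule conic_points_count[OF _ _ uvw])
        show "finite (?g ` ?F)" using fin by simp
        show "(double_part A0, double_part B0, double_part (A0 + B0)) \<in> ?g ` ?F"
          by (rule image_eqI[of _ _ "(A0, B0)"]) (use 0 in simp_all)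
        fix x y z assume "(x, y, z) \<in> ?g ` ?F"
        then obtain A B where AB: "(A, B) \<in> ?F"
          and xyz: "x = double_part A" "y = double_part B" "z = double_part (A + B)" by auto
        then have AB': "(A, B) \<in> S" by simp
        show "0 < x \<and> x \<le> X2 \<and> 0 < y \<and> y \<le> Y2 \<and> 0 < z \<and> z \<le> Z2 \<and> Z2 \<le> 2 * z"
          using mem[OF AB'] parts_pos[of A] parts_pos[of B] parts_pos[of "A + B"] cap_parts[OF AB']
          by (simp add: xyz)
        show "?u * x\<^sup>2 + ?v * y\<^sup>2 = ?w * z\<^sup>2 \<and> ?u * x\<^sup>2 \<le> ?v * y\<^sup>2 \<and> coprime (?u * x\<^sup>2) (?v * y\<^sup>2)"
          unfolding xyz eq[OF AB] using mem[OF AB'] by simp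
      qed
      have w: "?w * (double_part (A0 + B0))\<^sup>2 = A0 + B0" using eq(3)[of A0 B0] 0 by simp
      have c: "0 < real (A0 + B0)" using mem(1)[OF 0(1)] by simp
      \<comment> \<open>Both sides are the product of all nine caps, so \<open>ratio\<close> serves
        the conics too.\<close>
      have PQ: "real X2 * real Y2 * real Z2 * Q = real X1 * real Y1 * real Z1 * P"
        by (simp add: P_def Q_def mult_ac)
      have "4 * (real X2 * real Y2 * real Z2) / real (A0 + B0) \<le> 2048 * G / Q"
        unfolding pos_divide_le_eq[OF c] times_divide_eq_left pos_le_divide_eq[OF Q]
        using mult_left_mono[OF ratio[OF 0(1), folded PQ], of 4] by simp
      moreover have "real (card {d. d dvd ?u} * (card {d. d dvd ?v} * card {d. d dvd ?w})) \<le> E ^ 3"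
      proof -
        have "?u dvd A0" "?v dvd B0" "?w dvd A0 + B0"
          using eq[of A0 B0] 0 dvd_triv_left by (metis (mono_tags, lifting) mem_Collect_eq)+
        then have "?u \<le> N" "?v \<le> N" "?w \<le> N"
          using mem[OF 0(1)] dvd_imp_le by (metis add_gr_0 le_add1 le_add2 le_trans order_less_le_trans)+
        then have "real (card {d. d dvd ?u}) \<le> E" "real (card {d. d dvd ?v}) \<le> E" "real (card {d. d dvd ?w}) \<le> E"
          using divE uvw by auto
        then have "real (card {d. d dvd ?u}) * (real (card {d. d dvd ?v}) * real (card {d. d dvd ?w})) \<le> E * (E * E)"
          using E by (intro mult_mono) auto
        then show ?thesis by (simp add: power3_eq_cube)
      qed
      ultimately have "real (card {d. d dvd ?u} * (card {d. d dvd ?v} * card {d. d dvd ?w})) *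
          (1 + 4 * (real X2 * real Y2 * real Z2) / real (A0 + B0)) \<le> E ^ 3 * (1 + 2048 * G / Q)"
        using E by (intro mult_mono) auto
      then show "real (card ?F) \<le> E ^ 3 * (1 + 2048 * G / Q)"
        using cnt unfolding w card_image[OF inj] by linarith
    next
      show "real (card (f ` S)) \<le> E ^ 3 * Q"
        unfolding Q_def
      proof (rule fixed_parts_count[OF _ radE])
        show "f ` S \<subseteq> {1..X1} \<times> {m. 0 < m \<and> m \<le> N \<and> rad m \<le> X3} \<times>
          {1..Y1} \<times> {m. 0 < m \<and> m \<le> N \<and> rad m \<le> Y3} \<times>
          {1..Z1} \<times> {m. 0 < m \<and> m \<le> N \<and> rad m \<le> Z3}"
        proof
          fix k assume "k \<in> f ` S"
          then obtain A B where AB: "(A, B) \<in> S" "k = f (A, B)" by auto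
          have "0 < A" "0 < B" "0 < A + B" "A \<le> N" "B \<le> N" "A + B \<le> N" using mem[OF AB(1)] by auto
          then show "k \<in> {1..X1} \<times> {m. 0 < m \<and> m \<le> N \<and> rad m \<le> X3} \<times>
            {1..Y1} \<times> {m. 0 < m \<and> m \<le> N \<and> rad m \<le> Y3} \<times>
            {1..Z1} \<times> {m. 0 < m \<and> m \<le> N \<and> rad m \<le> Z3}"
            using cap_parts[OF AB(1)] parts_pos[of A] parts_pos[of B] parts_pos[of "A + B"]
              parts_le[of A] parts_le[of B] parts_le[of "A + B"]
            by (simp add: AB(2) f_def Suc_le_eq)
        qed
      qed (use E in simp)
    qed (use E G Q in simp)
    moreover have "(E ^ 3 * Q) * (E ^ 3 * (1 + 2048 * G / Q)) = E ^ 6 * (Q + 2048 * G)"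
    proof -
      have "(E ^ 3 * Q) * (E ^ 3 * (1 + 2048 * G / Q)) = (E ^ 3 * E ^ 3) * (Q * (1 + 2048 * G / Q))"
        by (simp only: mult_ac)
      also have "E ^ 3 * E ^ 3 = E ^ 6" using power_add[of E 3 3] by simp
      also have "Q * (1 + 2048 * G / Q) = Q + 2048 * G" using Q by (simp add: distrib_left)
      finally show ?thesis .
    qed
    ultimately show ?thesis by simp
  qed
  obtain A B where AB: "(A, B) \<in> S" using ne by auto
  \<comment> \<open>First caps occur only in \<open>Q\<close>, second only in \<open>P\<close>,
    third in both: the exponents are 1, 2, 3 as in \<open>caps_le\<close>. So \<open>P\<close> and
    \<open>Q\<close> cannot both exceed \<open>64 * real N\<close>.\<close>
  have "P * P * Q \<le> (64 * real N) ^ 3"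
  proof -
    have N: "0 < A" "0 < B" "0 < A + B" "A \<le> N" "B \<le> N" "A + B \<le> N" using mem[OF AB] by auto
    have x: "X1 * X2\<^sup>2 * X3 ^ 3 \<le> 64 * N"
      by (rule order_trans[OF caps_le[OF N(1) capsA[OF AB]]]) (use N in simp)
    have y: "Y1 * Y2\<^sup>2 * Y3 ^ 3 \<le> 64 * N"
      by (rule order_trans[OF caps_le[OF N(2) capsB[OF AB]]]) (use N in simp)
    have z: "Z1 * Z2\<^sup>2 * Z3 ^ 3 \<le> 64 * N"
      by (rule order_trans[OF caps_le[OF N(3) capsC[OF AB]]]) (use N in simp)
    have "(X1 * X2\<^sup>2 * X3 ^ 3) * ((Y1 * Y2\<^sup>2 * Y3 ^ 3) * (Z1 * Z2\<^sup>2 * Z3 ^ 3)) \<le>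
        (64 * N) * ((64 * N) * (64 * N))"
      by (rule mult_le_mono[OF x mult_le_mono[OF y z]])
    then have "real ((X1 * X2\<^sup>2 * X3 ^ 3) * ((Y1 * Y2\<^sup>2 * Y3 ^ 3) * (Z1 * Z2\<^sup>2 * Z3 ^ 3))) \<le>
        real ((64 * N) * ((64 * N) * (64 * N)))"
      by (rule of_nat_mono)
    then show ?thesis
      by (simp add: P_def Q_def power2_eq_square power3_eq_cube mult_ac)
  qed
  moreover have "(64 * real N) ^ 3 < P * P * Q" if "64 * real N < P" "64 * real N < Q"
    unfolding power3_eq_cube using that by (intro mult_strict_mono) auto
  ultimately consider "P \<le> 64 * real N" | "Q \<le> 64 * real N" by linarith
  then show ?thesis
  proof cases
    case 1
    have "0 \<le> P" by (simp add: P_def)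
    then have "E ^ 3 * (P + 2048 * G) \<le> E ^ 6 * (64 * real N + 2048 * G)"
      using 1 E G by (intro mult_mono power_increasing) auto
    then show ?thesis using linear unfolding G_def by linarith
  next
    case 2
    have "E ^ 6 * (Q + 2048 * G) \<le> E ^ 6 * (64 * real N + 2048 * G)"
      using 2 E by (intro mult_left_mono) auto
    then show ?thesis using conic unfolding G_def by linarith
  qed
qed

section \<open>Summing over the dyadic boxes and absorbing all losses into N^\<epsilon>\<close>

lemma floor_log_bound:
  assumes "0 < \<delta>" "0 < N"
  shows "real (floor_log N + 1) \<le> (1 + 1 / (\<delta> * ln 2)) * real N powr \<delta>"
proof -
  have "2 ^ floor_log N \<le> N" using assms(2) by (rule floor_log_exp2_le)
  then have "real (2 ^ floor_log N) \<le> real N" by (rule of_nat_mono)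
  then have "real (floor_log N) \<le> log 2 (real N)"
    by (intro le_log_of_power) auto
  also have "\<dots> = ln (real N) / ln 2" by (simp add: log_def)
  also have "\<dots> \<le> (real N powr \<delta> / \<delta>) / ln 2"
    using assms by (intro divide_right_mono ln_powr_bound) auto
  finally have "real (floor_log N) \<le> 1 / (\<delta> * ln 2) * real N powr \<delta>" by (simp add: field_simps)
  moreover have "1 \<le> real N powr \<delta>" using assms by (intro ge_one_powr_ge_zero) auto
  ultimately show ?thesis by (simp add: distrib_right)
qed

lemma ordered_pairs_count:
  assumes abc: "0 < a" "0 < b" "0 < c" and "0 < N"
    and E: "1 \<le> E"
    and divE: "\<And>n. 0 < n \<Longrightarrow> n \<le> N \<Longrightarrow> real (card {d. d dvd n}) \<le> E"
    and radE: "\<And>R. real (card {m. 0 < m \<and> m \<le> N \<and> rad m \<le> R}) \<le> real R * E"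
  shows "real (card (ordered_pairs a b c N)) \<le> real (floor_log N + 1) ^ 9 *
    (E ^ 6 * (64 * real N + 2048 * (real N powr (a + b + c - 1) + 1)))"
proof (rule card_le_fibres[OF finite_ordered_pairs, where f = "\<lambda>(A, B). (caps A, caps B, caps (A + B))"])
  let ?S = "ordered_pairs a b c N" and ?f = "\<lambda>(A, B). (caps A, caps B, caps (A + B))"
  {
    fix k assume k: "k \<in> ?f ` ?S"
    obtain X1 X2 X3 Y1 Y2 Y3 Z1 Z2 Z3 where k': "k = ((X1, X2, X3), (Y1, Y2, Y3), (Z1, Z2, Z3))"
      by (metis surj_pair)
    show "real (card {s \<in> ?S. ?f s = k})
        \<le> E ^ 6 * (64 * real N + 2048 * (real N powr (a + b + c - 1) + 1))"
    proof (rule box_count[OF abc _ _ E divE radE])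
      show "{s \<in> ?S. ?f s = k} \<subseteq> ?S" by simp
      show "{s \<in> ?S. ?f s = k} \<noteq> {}" using k by auto
      show "caps A = (X1, X2, X3) \<and> caps B = (Y1, Y2, Y3) \<and> caps (A + B) = (Z1, Z2, Z3)"
        if "(A, B) \<in> {s \<in> ?S. ?f s = k}" for A B
        using that by (simp add: k')
    qed
  }
  \<comment> \<open>Every part is at most \<open>N\<close>, so its cap is one of
    \<open>floor_log N + 1\<close> powers of two; a box has nine caps.\<close>
  let ?V = "(\<lambda>k. 2 * 2 ^ k) ` {..floor_log N} :: nat set"
  have V: "cap n \<in> ?V" if "n \<le> N" for n
    using floor_log_le_iff[OF that] by (auto simp: cap_def)
  have caps: "caps n \<in> ?V \<times> ?V \<times> ?V" if "0 < n" "n \<le> N" for n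
  proof -
    have "rad (cubefull_part n) \<le> cubefull_part n"
      using that parts_pos by (intro rad_le)
    then have "simple_part n \<le> N" "double_part n \<le> N" "rad (cubefull_part n) \<le> N"
      using parts_le[OF that(1)] that(2) by linarith+
    then show ?thesis unfolding caps_def using V by blast
  qed
  have sub: "?f ` ?S \<subseteq> (?V \<times> ?V \<times> ?V) \<times> (?V \<times> ?V \<times> ?V) \<times> (?V \<times> ?V \<times> ?V)"
  proof
    fix k assume "k \<in> ?f ` ?S"
    then obtain A B where AB: "(A, B) \<in> ?S" "k = ?f (A, B)" by auto
    then have "0 < A" "0 < B" "0 < A + B" "A \<le> N" "B \<le> N" "A + B \<le> N"
      by (auto simp: ordered_pairs_def)
    then have "caps A \<in> ?V \<times> ?V \<times> ?V" "caps B \<in> ?V \<times> ?V \<times> ?V" "caps (A + B) \<in> ?V \<times> ?V \<times> ?V"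
      by (auto intro!: caps simp del: mem_Times_iff)
    then show "k \<in> (?V \<times> ?V \<times> ?V) \<times> (?V \<times> ?V \<times> ?V) \<times> (?V \<times> ?V \<times> ?V)"
      unfolding AB(2) prod.case by (intro SigmaI)
  qed
  have "card (?f ` ?S) \<le> card ((?V \<times> ?V \<times> ?V) \<times> (?V \<times> ?V \<times> ?V) \<times> (?V \<times> ?V \<times> ?V))"
    using sub by (intro card_mono finite_cartesian_product finite_imageI) auto
  also have "\<dots> = card ?V ^ 9"
    by (simp only: card_cartesian_product) (simp add: eval_nat_numeral mult_ac)
  also have "\<dots> \<le> (floor_log N + 1) ^ 9"
    using card_image_le[of "{..floor_log N}" "\<lambda>k. 2 * 2 ^ k :: nat"] by (intro power_mono) auto
  finally have "real (card (?f ` ?S)) \<le> real ((floor_log N + 1) ^ 9)" by (rule of_nat_mono)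
  then show "real (card (?f ` ?S)) \<le> real (floor_log N + 1) ^ 9" by simp
next
  show "0 \<le> E ^ 6 * (64 * real N + 2048 * (real N powr (a + b + c - 1) + 1))"
    using E by (intro mult_nonneg_nonneg add_nonneg_nonneg) auto
qed

text \<open>\<open>K\<close> is chosen before the exponents, so that one constant serves all their
  permutations.\<close>

lemma ordered_pairs_bound:
  assumes "0 < \<epsilon>"
  obtains K :: real where "0 \<le> K"
    "\<And>a b c N. 0 < a \<Longrightarrow> 0 < b \<Longrightarrow> 0 < c \<Longrightarrow> 0 < N \<Longrightarrow>
      real (card (ordered_pairs a b c N)) \<le>
        K * (real N powr (a + b + c - 1 + \<epsilon>) + real N powr (1 + \<epsilon>))"
proof -
  \<comment> \<open>15 = 9 + 6: nine dyadic scales and the sixth power of \<open>E\<close>.\<close>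
  define \<delta> where "\<delta> = \<epsilon> / 15"
  have \<delta>: "0 < \<delta>" using assms by (simp add: \<delta>_def)
  obtain C where C: "1 \<le> C"
    "\<And>S N. finite S \<Longrightarrow> (\<And>p. p \<in> S \<Longrightarrow> prime p) \<Longrightarrow> \<Prod>S \<le> N \<Longrightarrow>
       real (factored_count S N) \<le> C * real N powr \<delta>"
    using factored_count_bound[OF \<delta>] by metis
  define D where "D = 1 + 1 / (\<delta> * ln 2)"
  have D: "1 \<le> D" using \<delta> by (simp add: D_def)
  show thesis
  proof (rule that[of "D ^ 9 * C ^ 6 * 2112"])
    show "0 \<le> D ^ 9 * C ^ 6 * 2112" using C D by simp
    fix a b c :: real and N :: nat
    assume abc: "0 < a" "0 < b" "0 < c" and N: "0 < N"
    define n where "n = real N powr \<delta>"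
    have n: "1 \<le> n" unfolding n_def using \<delta> N by (intro ge_one_powr_ge_zero) auto
    have divE: "real (card {d. d dvd m}) \<le> C * n" if m: "0 < m" "m \<le> N" for m
    proof -
      have "real (card {d. d dvd m}) \<le> real (factored_count (prime_factors m) m)"
        by (intro of_nat_mono divisor_count_le m)
      also have "\<dots> \<le> C * real m powr \<delta>"
        using rad_le[OF m(1)] by (intro C(2)) (auto simp: rad_def)
      also have "\<dots> \<le> C * n"
        unfolding n_def using m \<delta> C(1) by (intro mult_left_mono powr_mono2) auto
      finally show ?thesis .
    qed
    have radE: "real (card {m. 0 < m \<and> m \<le> N \<and> rad m \<le> R}) \<le> real R * (C * n)" for R
      unfolding n_def using C by (intro rad_count_le) auto
    have E: "1 \<le> C * n" using mult_mono[OF C(1) n] C(1) by simp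
    define M where "M = real N powr (a + b + c - 1) + real N"
    have "real (card (ordered_pairs a b c N)) \<le> real (floor_log N + 1) ^ 9 *
        ((C * n) ^ 6 * (64 * real N + 2048 * (real N powr (a + b + c - 1) + 1)))"
      by (rule ordered_pairs_count[OF abc N E divE radE])
    also have "\<dots> \<le> (D * n) ^ 9 * ((C * n) ^ 6 * (2112 * M))"
    proof (intro mult_mono power_mono)
      show "real (floor_log N + 1) \<le> D * n"
        unfolding D_def n_def by (rule floor_log_bound[OF \<delta> N])
      \<comment> \<open>2112 is 64 + 2048; the summand 1 is absorbed by \<open>N\<close>, which is
        positive.\<close>
      have key: "64 * r + 2048 * (x + 1) \<le> 2112 * (x + r)" if "1 \<le> r" "0 \<le> x" for r x :: real
      proof -
        have "2112 * (x + r) = 64 * r + 2048 * (x + 1) + (64 * x + 2048 * (r - 1))"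
          by (simp add: algebra_simps)
        moreover have "0 \<le> 64 * x + 2048 * (r - 1)" using that by simp
        ultimately show ?thesis by linarith
      qed
      show "64 * real N + 2048 * (real N powr (a + b + c - 1) + 1) \<le> 2112 * M"
        unfolding M_def by (rule key) (use N in simp_all)
    qed (use C D n in auto)
    also have "\<dots> = D ^ 9 * C ^ 6 * 2112 * (n ^ 15 * M)"
    proof -
      have "n ^ 15 = n ^ 9 * n ^ 6" using power_add[of n 9 6] by simp
      then show ?thesis by (simp add: power_mult_distrib mult_ac)
    qed
    also have "n ^ 15 = real N powr \<epsilon>"
    proof -
      have "n ^ 15 = n powr 15" using n by (simp add: powr_numeral)
      then show ?thesis by (simp add: n_def powr_powr \<delta>_def)
    qed
    also have "real N powr \<epsilon> * M = real N powr (a + b + c - 1 + \<epsilon>) + real N powr (1 + \<epsilon>)"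
      using N by (simp add: M_def distrib_left powr_add mult.commute)
    finally show "real (card (ordered_pairs a b c N)) \<le> D ^ 9 * C ^ 6 * 2112 *
        (real N powr (a + b + c - 1 + \<epsilon>) + real N powr (1 + \<epsilon>))" .
  qed
qed

section \<open>From triples of integers to ordered pairs\<close>

lemma restricted_triples_swap:
  assumes "(A, B, C) \<in> restricted_triples a b c N"
  shows "(B, A, C) \<in> restricted_triples b a c N" "(A, C, B) \<in> restricted_triples a c b N"
proof -
  have "{B, A, C} = {A, B, C}" "{A, C, B} = {A, B, C}" by auto
  then show "(B, A, C) \<in> restricted_triples b a c N" "(A, C, B) \<in> restricted_triples a c b N"
    using assms unfolding restricted_triples_def mem_Collect_eq prod.case
    by (simp_all only: add_ac simp_thms)
qed

lemma restricted_triples_permute: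
  assumes "(A, B, C) \<in> restricted_triples a b c N"
  shows "(B, A, C) \<in> restricted_triples b a c N" "(A, C, B) \<in> restricted_triples a c b N"
    "(B, C, A) \<in> restricted_triples b c a N" "(C, A, B) \<in> restricted_triples c a b N"
    "(C, B, A) \<in> restricted_triples c b a N"
proof -
  show 1: "(B, A, C) \<in> restricted_triples b a c N" and 2: "(A, C, B) \<in> restricted_triples a c b N"
    by (rule restricted_triples_swap[OF assms])+
  show 3: "(B, C, A) \<in> restricted_triples b c a N" by (rule restricted_triples_swap(2)[OF 1])
  show "(C, A, B) \<in> restricted_triples c a b N" by (rule restricted_triples_swap(1)[OF 2])
  show "(C, B, A) \<in> restricted_triples c b a N" by (rule restricted_triples_swap(1)[OF 3])
qed

definition sorted_triples :: "real \<Rightarrow> real \<Rightarrow> real \<Rightarrow> nat \<Rightarrow> (int \<times> int \<times> int) set" where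
  "sorted_triples a b c N = {(A, B, C) \<in> restricted_triples a b c N. \<bar>A\<bar> \<le> \<bar>B\<bar> \<and> \<bar>B\<bar> \<le> \<bar>C\<bar>}"

lemma finite_sorted_triples: "finite (sorted_triples a b c N)"
  by (rule finite_subset[OF _ finite_restricted_triples]) (auto simp: sorted_triples_def)

text \<open>If \<open>A\<close> and \<open>B\<close> had opposite signs, their sum would be smaller
  in absolute value than \<open>B\<close>, against the maximality of \<open>C\<close>.\<close>

lemma sorted_triples_ordered_pairs:
  assumes "(A, B, C) \<in> sorted_triples a b c N"
  shows "\<bar>C\<bar> = \<bar>A\<bar> + \<bar>B\<bar>" "(nat \<bar>A\<bar>, nat \<bar>B\<bar>) \<in> ordered_pairs a b c N"
proof -
  have mem: "A \<noteq> 0" "B \<noteq> 0" "C \<noteq> 0" "Gcd {A, B, C} = 1" "A + B + C = 0" "\<bar>C\<bar> \<le> int N"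
      "\<bar>A\<bar> \<le> \<bar>B\<bar>" "\<bar>B\<bar> \<le> \<bar>C\<bar>"
    and rads: "real_of_int (int_radical A) \<le> \<bar>real_of_int A\<bar> powr a"
       "real_of_int (int_radical B) \<le> \<bar>real_of_int B\<bar> powr b"
       "real_of_int (int_radical C) \<le> \<bar>real_of_int C\<bar> powr c"
    using assms by (auto simp: sorted_triples_def restricted_triples_def)
  show C: "\<bar>C\<bar> = \<bar>A\<bar> + \<bar>B\<bar>" using mem by linarith
  then have natC: "nat \<bar>C\<bar> = nat \<bar>A\<bar> + nat \<bar>B\<bar>" by (simp add: nat_add_distrib)
  have "coprime A B"
  proof (rule coprimeI)
    fix d assume d: "d dvd A" "d dvd B"
    have "C = - (A + B)" using mem by simp
    then have "d dvd C" using d by simp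
    then have "d dvd Gcd {A, B, C}" using d by (intro Gcd_greatest) auto
    then show "is_unit d" unfolding mem(4) .
  qed
  then have "coprime (int (nat \<bar>A\<bar>)) (int (nat \<bar>B\<bar>))" by simp
  then have cop: "coprime (nat \<bar>A\<bar>) (nat \<bar>B\<bar>)" by (simp only: coprime_int_iff)
  have abs: "\<bar>real_of_int x\<bar> = real (nat \<bar>x\<bar>)" for x by simp
  have "real (rad (nat \<bar>A\<bar>)) \<le> real (nat \<bar>A\<bar>) powr a" "real (rad (nat \<bar>B\<bar>)) \<le> real (nat \<bar>B\<bar>) powr b"
    "real (rad (nat \<bar>A\<bar> + nat \<bar>B\<bar>)) \<le> real (nat \<bar>A\<bar> + nat \<bar>B\<bar>) powr c"
    using rads unfolding int_radical_eq abs natC by (simp_all only: of_int_of_nat_eq)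
  moreover have "0 < nat \<bar>A\<bar>" "nat \<bar>A\<bar> \<le> nat \<bar>B\<bar>" "nat \<bar>A\<bar> + nat \<bar>B\<bar> \<le> N"
    using mem(1,6,7) unfolding natC[symmetric] by (auto intro: nat_mono)
  ultimately show "(nat \<bar>A\<bar>, nat \<bar>B\<bar>) \<in> ordered_pairs a b c N"
    using cop by (simp only: ordered_pairs_def mem_Collect_eq prod.case simp_thms)
qed

text \<open>The factor 2 is the common sign of \<open>A\<close> and \<open>B\<close>; with it the
  absolute values determine the triple.\<close>

lemma card_sorted_triples_le:
  "card (sorted_triples a b c N) \<le> 2 * card (ordered_pairs a b c N)"
proof -
  let ?f = "\<lambda>(A, B, C :: int). (0 < A, nat \<bar>A :: int\<bar>, nat \<bar>B :: int\<bar>)"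
  have "card (sorted_triples a b c N) \<le> card ((UNIV :: bool set) \<times> ordered_pairs a b c N)"
  proof (rule card_inj_on_le)
    show "?f ` sorted_triples a b c N \<subseteq> UNIV \<times> ordered_pairs a b c N"
    proof
      fix k assume "k \<in> ?f ` sorted_triples a b c N"
      then obtain A B C where "(A, B, C) \<in> sorted_triples a b c N" "k = ?f (A, B, C)" by auto
      then show "k \<in> UNIV \<times> ordered_pairs a b c N"
        using sorted_triples_ordered_pairs(2) by simp
    qed
    show "inj_on ?f (sorted_triples a b c N)"
    proof (rule inj_onI)
      fix s t assume st: "s \<in> sorted_triples a b c N" "t \<in> sorted_triples a b c N" "?f s = ?f t"
      obtain A B C A' B' C' where s: "s = (A, B, C)" and t: "t = (A', B', C')"
        by (metis surj_pair)
      have signs: "(if 0 < x then \<bar>x\<bar> else - \<bar>x\<bar>) = x" "(if 0 < x then \<bar>y\<bar> else - \<bar>y\<bar>) = y" "z = - (x + y)"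
        if "(x, y, z) \<in> sorted_triples a b c N" for x y z
      proof -
        have "x \<noteq> 0" "x + y + z = 0"
          using that by (auto simp: sorted_triples_def restricted_triples_def)
        moreover have "\<bar>z\<bar> = \<bar>x\<bar> + \<bar>y\<bar>" by (rule sorted_triples_ordered_pairs(1)[OF that])
        ultimately show "(if 0 < x then \<bar>x\<bar> else - \<bar>x\<bar>) = x"
          "(if 0 < x then \<bar>y\<bar> else - \<bar>y\<bar>) = y" "z = - (x + y)"
          by (auto split: if_splits)
      qed
      have "0 < A \<longleftrightarrow> 0 < A'" "nat \<bar>A\<bar> = nat \<bar>A'\<bar>" "nat \<bar>B\<bar> = nat \<bar>B'\<bar>"
        using st(3) unfolding s t prod.case prod.inject by blast+
      then have "0 < A \<longleftrightarrow> 0 < A'" "\<bar>A\<bar> = \<bar>A'\<bar>" "\<bar>B\<bar> = \<bar>B'\<bar>"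
        by (simp_all add: eq_nat_nat_iff)
      then have "A = A'" "B = B'"
        using signs(1,2)[OF st(1)[unfolded s]] signs(1,2)[OF st(2)[unfolded t]] by metis+
      then show "s = t"
        using signs(3)[OF st(1)[unfolded s]] signs(3)[OF st(2)[unfolded t]] by (simp add: s t)
    qed
  qed (simp add: finite_ordered_pairs)
  then show ?thesis by (simp add: card_cartesian_product)
qed

text \<open>One summand for each order of the absolute values; the exponents travel with their
  entries. Ties make the six images overlap, which is harmless in an upper bound.\<close>

lemma restricted_count_le:
  "restricted_count a b c N \<le> 2 * (card (ordered_pairs a b c N) + card (ordered_pairs b a c N) +
     card (ordered_pairs a c b N) + card (ordered_pairs b c a N) + card (ordered_pairs c a b N) +
     card (ordered_pairs c b a N))"
proof -
  let ?U = "sorted_triples a b c N \<union> (\<lambda>(x, y, z). (y, x, z)) ` sorted_triples b a c N \<union>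
    (\<lambda>(x, y, z). (x, z, y)) ` sorted_triples a c b N \<union> (\<lambda>(x, y, z). (z, x, y)) ` sorted_triples b c a N \<union>
    (\<lambda>(x, y, z). (y, z, x)) ` sorted_triples c a b N \<union> (\<lambda>(x, y, z). (z, y, x)) ` sorted_triples c b a N"
  have "restricted_triples a b c N \<subseteq> ?U"
  proof
    fix s assume "s \<in> restricted_triples a b c N"
    moreover obtain A B C where s: "s = (A, B, C)" by (metis surj_pair)
    ultimately have R: "(A, B, C) \<in> restricted_triples a b c N" by simp
    note R' = R restricted_triples_permute[OF R]
    consider "\<bar>A\<bar> \<le> \<bar>B\<bar>" "\<bar>B\<bar> \<le> \<bar>C\<bar>" | "\<bar>B\<bar> \<le> \<bar>A\<bar>" "\<bar>A\<bar> \<le> \<bar>C\<bar>" | "\<bar>A\<bar> \<le> \<bar>C\<bar>" "\<bar>C\<bar> \<le> \<bar>B\<bar>"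
      | "\<bar>B\<bar> \<le> \<bar>C\<bar>" "\<bar>C\<bar> \<le> \<bar>A\<bar>" | "\<bar>C\<bar> \<le> \<bar>A\<bar>" "\<bar>A\<bar> \<le> \<bar>B\<bar>" | "\<bar>C\<bar> \<le> \<bar>B\<bar>" "\<bar>B\<bar> \<le> \<bar>A\<bar>"
      by linarith
    then show "s \<in> ?U"
    proof cases
      case 1
      then have "(A, B, C) \<in> sorted_triples a b c N" using R' by (simp add: sorted_triples_def)
      then show ?thesis by (simp add: s)
    next
      case 2
      then have "(B, A, C) \<in> sorted_triples b a c N" using R' by (simp add: sorted_triples_def)
      then show ?thesis by (force simp: s)
    next
      case 3
      then have "(A, C, B) \<in> sorted_triples a c b N" using R' by (simp add: sorted_triples_def)
      then show ?thesis by (force simp: s)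
    next
      case 4
      then have "(B, C, A) \<in> sorted_triples b c a N" using R' by (simp add: sorted_triples_def)
      then show ?thesis by (force simp: s)
    next
      case 5
      then have "(C, A, B) \<in> sorted_triples c a b N" using R' by (simp add: sorted_triples_def)
      then show ?thesis by (force simp: s)
    next
      case 6
      then have "(C, B, A) \<in> sorted_triples c b a N" using R' by (simp add: sorted_triples_def)
      then show ?thesis by (force simp: s)
    qed
  qed
  then have "restricted_count a b c N \<le> card ?U"
    unfolding restricted_count_def by (rule card_mono[rotated]) (simp add: finite_sorted_triples)
  also have "\<dots> \<le> card (sorted_triples a b c N) + card (sorted_triples b a c N) +
     card (sorted_triples a c b N) + card (sorted_triples b c a N) + card (sorted_triples c a b N) +
     card (sorted_triples c b a N)"
    by (intro order_trans[OF card_Un_le] add_mono order_refl card_image_le finite_sorted_triples)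
  also have "\<dots> \<le> 2 * card (ordered_pairs a b c N) + 2 * card (ordered_pairs b a c N) +
     2 * card (ordered_pairs a c b N) + 2 * card (ordered_pairs b c a N) + 2 * card (ordered_pairs c a b N) +
     2 * card (ordered_pairs c b a N)"
    by (intro add_mono card_sorted_triples_le)
  finally show ?thesis by simp
qed

theorem theorem3:
  fixes a b c \<epsilon> :: real
  assumes "0 < a" "a \<le> 1" "0 < b" "b \<le> 1" "0 < c" "c \<le> 1"
    and "\<epsilon> > 0"
  shows "\<exists>K. \<forall>N::nat. N > 0 \<longrightarrow>
    real (restricted_count a b c N)
      \<le> K * (real N powr (a + b + c - 1 + \<epsilon>) + real N powr (1 + \<epsilon>))"
proof -
  obtain K :: real where K: "\<And>a b c N. 0 < a \<Longrightarrow> 0 < b \<Longrightarrow> 0 < c \<Longrightarrow> 0 < N \<Longrightarrow>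
      real (card (ordered_pairs a b c N)) \<le>
        K * (real N powr (a + b + c - 1 + \<epsilon>) + real N powr (1 + \<epsilon>))"
    using ordered_pairs_bound[OF assms(7)] by metis
  \<comment> \<open>12 is six orders times two signs, and the bound depends on the exponents only
    through their sum.\<close>
  show ?thesis
  proof (intro exI[of _ "12 * K"] allI impI)
    fix N :: nat assume N: "N > 0"
    define M where "M = K * (real N powr (a + b + c - 1 + \<epsilon>) + real N powr (1 + \<epsilon>))"
    have perm: "b + a + c = a + b + c" "a + c + b = a + b + c" "b + c + a = a + b + c"
      "c + a + b = a + b + c" "c + b + a = a + b + c" by simp_all
    have "real (card (ordered_pairs a b c N)) \<le> M" "real (card (ordered_pairs b a c N)) \<le> M"
      "real (card (ordered_pairs a c b N)) \<le> M" "real (card (ordered_pairs b c a N)) \<le> M"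
      "real (card (ordered_pairs c a b N)) \<le> M" "real (card (ordered_pairs c b a N)) \<le> M"
      unfolding M_def
      using K[of a b c N] K[of b a c N, unfolded perm] K[of a c b N, unfolded perm]
        K[of b c a N, unfolded perm] K[of c a b N, unfolded perm] K[of c b a N, unfolded perm] assms N
      by simp_all
    then have "real (restricted_count a b c N) \<le> 12 * M"
      using of_nat_mono[OF restricted_count_le[of a b c N], where 'a=real] by simp
    then show "real (restricted_count a b c N)
      \<le> 12 * K * (real N powr (a + b + c - 1 + \<epsilon>) + real N powr (1 + \<epsilon>))"
      by (simp add: M_def)
  qed
qed

end
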